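(* Let $(V,\mathbf d_V)$ be a complete metric space, $\mathcal K\subseteq V$ a closed subset, $X$ a reflexive (real) Banach space whose dual $X'$ is strictly convex, $E\subseteq X$ a nonempty closed convex set, and let $f_0:V\to\mathbb R$ and $f:V\to X$ be continuous. Let $\bar u\in\mathcal K$ be a solution of the problem: minimize $f_0(u)$ subject to $f(u)\in E$ and $u\in\mathcal K$ (that is, $f(\bar u)\in E$ and $f_0(\bar u)=\min\{f_0(u): u\in \mathcal K,\ f(u)\in E\}$), and put $\bar e=f(\bar u)$. Assume that there are a set-valued map $\mathcal V:\mathcal K\rightsquigarrow\mathbb R\times X$ with $\mathcal V(u)\subseteq \mathrm{Var}_{\mathcal K}(f_0,f)(u)$ for every $u\in\mathcal K$, and a modulus of continuity $\ell:[0,+\infty)\to[0,+\infty)$ with $\lim_{s\to0^+}\ell(s)=0$, such that (H1) for any $(\xi_1,\xi_2)\in\mathcal V(\bar u)$ and any $u^\varepsilon\in\mathcal K$ with $\mathbf d_V(\bar u,u^\varepsilon)\to0$ as $\varepsilon\to0^+$, there is $(\xi_1^\varepsilon,\xi_2^\varepsilon)\in\mathcal V(u^\varepsilon)$ such that $\xi_1^\varepsilon\to\xi_1$ in $\mathbb R$ as $\varepsilon\to0^+$ and, for small enough $\varepsilon$, $|\xi_2-\xi_2^\varepsilon|_X\le\ell(\mathbf d_V(\bar u,u^\varepsilon))$; (H2) the set-valued map $u\mapsto\pi_{\mathbb R}(\mathcal V(u))$ is locally bounded at $\bar u$, i.e. there are $\delta,C>0$ with $|\xi_1|\le C$ for all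 $u\in\mathcal K$ with $\mathbf d_V(u,\bar u)\le\delta$ and all $\xi_1\in\pi_{\mathbb R}(\mathcal V(u))$; (H3) the set $\pi_X(\mathcal V(\bar u))-E$ is finite codimensional in $X$. Then there is a pair $(z_0,z)\in[0,+\infty)\times X'$ with $(z_0,z)\ne(0,0)$ and $z\in\mathcal N_E(\bar e)$ such that $$z_0\xi_1+\langle z,\xi_2\rangle_{X',X}\ge0\qquad\forall\,(\xi_1,\xi_2)\in\mathcal V(\bar u),$$ and, moreover, the following hold. (i) If $z_0\ne0$, then with $\tilde z=z/z_0$ one has $\xi_1+\langle\tilde z,\xi_2\rangle_{X',X}\ge0$ for all $(\xi_1,\xi_2)\in\mathcal V(\bar u)$. (ii) If $z\neq0$, then there is a sequence $\{u^k\}_{k=1}^\infty\subseteq\mathcal K$ converging to $\bar u$ as $k\to\infty$ such that $f(u^k)\notin E$ for all sufficiently large $k$, $\lim_{k\to\infty}\mathrm{dist}(f(u^k),E)=0$ and $\lim_{k\to\infty}f_0(u^k)=f_0(\bar u)$. Furthermore, when $X$ is a Hilbert space, the sequence $\{\mathcal P_E(f(u^k))\}_{k=1}^\infty$ satisfies $\mathcal P_E(f(u^k))\to f(\bar u)$ as $k\to\infty$ and $$\big(\hat z,\,f(u^k)-\mathcal P_E(f(u^k))\big)_X>0\qquad\forall\,k\in\mathbb N,$$ where $\hat z\in X$ is the element corresponding to $z\in X'$ by the Riesz–Fréchet isomorphism.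
   Context: Variation: for a map $g:V\to Y$ into a Banach space $Y$, $\mathcal K\subseteq V$ and $e\in\mathcal K$, $\mathrm{Var}_{\mathcal K}g(e)$ is the set of all $\xi\in Y$ for which there exist $h_k>0$ with $h_k\to0$ and $e_k\in\mathcal K$ with $\mathbf d_V(e_k,e)\le h_k$ and $\lim_{k\to\infty}\frac{g(e_k)-g(e)}{h_k}=\xi$. Here it is applied to $(f_0,f):V\to\mathbb R\times X$. For $S\subseteq\mathbb R\times X$, $\pi_{\mathbb R}(S)$ and $\pi_X(S)$ denote the projections of $S$ onto $\mathbb R$ and $X$. For sets $D_1,D_2\subseteq X$, $D_1-D_2=\{x_1-x_2: x_1\in D_1,x_2\in D_2\}$. Normal cone: $\mathcal N_E(e)=\{w\in X': \langle w,\tilde e-e\rangle_{X',X}\le0\ \forall\,\tilde e\in E\}$ for $e\in E$. $\mathrm{dist}(x,E)=\inf_{y\in E}|y-x|_X$. When $X$ is Hilbert, $\mathcal P_E(x)$ is the metric projection of $x$ onto $E$. A Banach space is strictly convex if $|\frac{x+y}2|<1$ whenever $|x|=|y|=1$, $x\ne y$. Finite codimensionality: a linear subspace $X_1$ of $X$ is finite codimensional if there are an integer $m\ge0$ and linearly independent $x_1,\dots,x_m\in X\setminus X_1$ with $\overline{X_1}+\mathrm{span}\{x_1,\dots,x_m\}=X$. A subset $D\subseteq X$ is finite codimensional in $X$ if there is $x_0\in\overline{\mathrm{co}}\,D$ (closed convex hull) such that (i) $\overline{\mathrm{span}}\{D-x_0\}$ is a finite codimensional subspace of $X$, and (ii)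 $\overline{\mathrm{co}}(D-x_0)$ has at least one interior point relative to the space $\overline{\mathrm{span}}\{D-x_0\}$.
   Formalization: In (H1), "for small enough ε" is taken with a threshold that may depend on the family u^ε but not on the point (ξ1, ξ2) in V(ū); with a threshold depending on (ξ1, ξ2) the claim fails, e.g. in X = l^2 with E = {0}. *)

theory Defs
  imports "HOL-Analysis.Analysis"
begin

definition variation ::
    "'v::metric_space set \<Rightarrow> ('v \<Rightarrow> 'y::banach) \<Rightarrow> 'v \<Rightarrow> 'y set" where
  "variation K g e =
     {\<xi>. \<exists>(h :: nat \<Rightarrow> real) (e' :: nat \<Rightarrow> 'v).
        (\<forall>k. h k > 0) \<and> h \<longlonglongrightarrow> 0 \<and>
        (\<forall>k. e' k \<in> K \<and> dist (e' k) e \<le> h k) \<and>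
        (\<lambda>k. (g (e' k) - g e) /\<^sub>R h k) \<longlonglongrightarrow> \<xi>}"

text \<open>The topological dual of a type \<open>'x\<close> is the type \<open>'x \<Rightarrow>\<^sub>L real\<close> with the operator
  norm, and the bidual is \<open>('x \<Rightarrow>\<^sub>L real) \<Rightarrow>\<^sub>L real\<close>. Reflexivity is surjectivity of the canonical
  map from \<open>'x\<close> into its bidual.\<close>

definition reflexive_space :: "'x::banach itself \<Rightarrow> bool" where
  "reflexive_space _ \<longleftrightarrow>
     (\<forall>\<phi> :: ('x \<Rightarrow>\<^sub>L real) \<Rightarrow>\<^sub>L real. \<exists>x :: 'x. \<forall>w :: 'x \<Rightarrow>\<^sub>L real.
        blinfun_apply \<phi> w = blinfun_apply w x)"

definition strictly_convex_space :: "'y::banach itself \<Rightarrow> bool" where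
  "strictly_convex_space _ \<longleftrightarrow>
     (\<forall>x y :: 'y. norm x = 1 \<and> norm y = 1 \<and> x \<noteq> y \<longrightarrow> norm ((x + y) /\<^sub>R 2) < 1)"

definition normal_cone :: "'x::banach set \<Rightarrow> 'x \<Rightarrow> ('x \<Rightarrow>\<^sub>L real) set" where
  "normal_cone E e = {w. \<forall>e'\<in>E. blinfun_apply w (e' - e) \<le> 0}"

text \<open>The finite set \<open>B\<close> plays the role of the vectors \<open>x\<^sub>1, \<dots>, x\<^sub>m\<close>.\<close>

definition finite_codim_subspace :: "'x::banach set \<Rightarrow> bool" where
  "finite_codim_subspace X1 \<longleftrightarrow> subspace X1 \<and>
     (\<exists>B. finite B \<and> independent B \<and> B \<inter> X1 = {} \<and>
          {x + y | x y. x \<in> closure X1 \<and> y \<in> span B} = UNIV)"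

text \<open>The interior is taken relative to the closed linear span; \<open>rel_interior\<close> would be relative
  to the affine hull, which need not be closed in infinite dimension.\<close>

definition finite_codim :: "'x::banach set \<Rightarrow> bool" where
  "finite_codim D \<longleftrightarrow>
     (\<exists>x0 \<in> closure (convex hull D).
        let D0 = (\<lambda>x. x - x0) ` D; L = closure (span D0) in
          finite_codim_subspace L \<and>
          (top_of_set L) interior_of (closure (convex hull D0)) \<noteq> {})"

text \<open>The approximation condition on a set-valued map \<open>\<V>\<close> at \<open>u0\<close>. A family \<open>(u\<^sup>\<epsilon>)\<close> with
  \<open>\<epsilon> > 0\<close> is a function on \<open>real\<close> whose values at nonpositive arguments are irrelevant. The bound
  \<open>\<epsilon>0\<close> below which the estimate by \<open>\<l>\<close> holds may depend on the family but not on the point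
  \<open>(\<xi>1, \<xi>2)\<close>: \<open>\<l>\<close> is meant as a modulus uniform over \<open>\<V> u0\<close>. The convergence of the first
  component, in contrast, is only pointwise.\<close>

definition approximable_at ::
    "'v::metric_space set \<Rightarrow> ('v \<Rightarrow> (real \<times> 'x::banach) set) \<Rightarrow> (real \<Rightarrow> real) \<Rightarrow> 'v \<Rightarrow> bool" where
  "approximable_at K \<V> \<l> u0 \<longleftrightarrow>
     (\<forall>u :: real \<Rightarrow> 'v.
        (\<forall>\<epsilon>>0. u \<epsilon> \<in> K) \<and> ((\<lambda>\<epsilon>. dist u0 (u \<epsilon>)) \<longlongrightarrow> 0) (at_right 0) \<longrightarrow>
        (\<exists>\<epsilon>0>0. \<forall>(\<xi>1, \<xi>2) \<in> \<V> u0.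
           \<exists>(\<eta>1 :: real \<Rightarrow> real) (\<eta>2 :: real \<Rightarrow> 'x).
             (\<forall>\<epsilon>>0. (\<eta>1 \<epsilon>, \<eta>2 \<epsilon>) \<in> \<V> (u \<epsilon>)) \<and>
             (\<eta>1 \<longlongrightarrow> \<xi>1) (at_right 0) \<and>
             (\<forall>\<epsilon>. 0 < \<epsilon> \<and> \<epsilon> < \<epsilon>0 \<longrightarrow> norm (\<xi>2 - \<eta>2 \<epsilon>) \<le> \<l> (dist u0 (u \<epsilon>)))))"

text \<open>A Banach space is a Hilbert space if its norm is induced by some inner product, which is
  then unique. The type class \<open>real_inner\<close> is not used, because only part of one statement about a
  general Banach space is specific to Hilbert spaces; \<open>closest_point\<close> is not used because it
  requires locally compact spaces.\<close>

definition norm_inducing_inner :: "('x::banach \<Rightarrow> 'x \<Rightarrow> real) \<Rightarrow> bool" where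
  "norm_inducing_inner ip \<longleftrightarrow>
     bilinear ip \<and> (\<forall>x y. ip x y = ip y x) \<and> (\<forall>x. ip x x = (norm x)\<^sup>2)"

definition riesz_element :: "('x::banach \<Rightarrow> 'x \<Rightarrow> real) \<Rightarrow> ('x \<Rightarrow>\<^sub>L real) \<Rightarrow> 'x" where
  "riesz_element ip z = (THE y. \<forall>x. blinfun_apply z x = ip y x)"

definition metric_projection :: "'x::banach set \<Rightarrow> 'x \<Rightarrow> 'x" where
  "metric_projection E x = (THE y. y \<in> E \<and> (\<forall>y'\<in>E. norm (x - y) \<le> norm (x - y')))"

end

theory Submission
  imports Defs
begin

text \<open>
  The proof penalizes the constraint. For \<open>\<epsilon> > 0\<close> let \<open>\<Phi>\<close> be the distance in \<open>real \<times> 'x\<close>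
  to the closed convex set \<open>Q = {..f0 u0 - \<epsilon>} \<times> E\<close>. Since \<open>u0\<close> is optimal, \<open>(f0 u, f u)\<close> never
  enters \<open>Q\<close> for \<open>u\<close> in \<open>K\<close>, whereas \<open>\<Phi> (f0 u0, f u0) \<le> \<epsilon>\<close>. Ekeland's variational principle gives a
  point \<open>u\<close> within \<open>sqrt \<epsilon>\<close> of \<open>u0\<close> from which \<open>\<Phi>\<close> composed with \<open>(f0, f)\<close> descends with slope at most
  \<open>sqrt \<epsilon>\<close>.

  Outside \<open>Q\<close> the function \<open>\<Phi>\<close> is Gateaux differentiable: all its subgradients have norm one, and
  the dual of \<open>real \<times> 'x\<close> is strictly convex because the dual of \<open>'x\<close> is
  (\<open>infdist_Gateaux_differentiable\<close>, \<open>strictly_convex_dual_prod\<close>). The derivative is a unit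
  functional \<open>(a, z)\<close> with \<open>a \<ge> 0\<close> and \<open>z\<close> an outer normal, and testing it with the variations at \<open>u\<close>
  gives the multiplier inequality up to an error \<open>sqrt \<epsilon>\<close> (\<open>approximate_multipliers\<close>).

  Letting \<open>\<epsilon>\<close> tend to zero, these functionals have a weak-star cluster point
  (\<open>weak_star_cluster_point\<close>). By the approximation hypothesis it satisfies the multiplier rule at
  \<open>u0\<close>. The remaining difficulty is that a weak-star limit of unit functionals can be zero. If it
  were, \<open>a\<close> would tend to zero, the local bound on the first components would remove them from the
  inequality, and \<open>z\<close> would be asymptotically nonnegative, uniformly, on the finite
  codimensional set of the third hypothesis. There weak-star convergence to zero implies convergence in norm
  (\<open>finite_codim_imp_norm_tendsto_0\<close>), which contradicts norm one.

  The sequence in the second part consists of Ekeland points. If the limit \<open>z\<close> is positive at a vector \<open>w\<close>,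
  then so are the approximating \<open>z\<close> frequently; these are therefore nonzero, which places
  \<open>f u\<close> outside \<open>E\<close>. In a Hilbert space the approximating \<open>z\<close> is a positive multiple of
  \<open>f u\<close> minus its projection, so taking the Riesz representative of the limit for \<open>w\<close> gives the sign
  condition.
\<close>

section \<open>Hahn--Banach, Banach--Alaoglu and Ekeland\<close>

definition sublinear :: "('a::real_vector \<Rightarrow> real) \<Rightarrow> bool" where
  "sublinear p \<longleftrightarrow> (\<forall>x y. p (x + y) \<le> p x + p y) \<and> (\<forall>c\<ge>0. \<forall>x. p (c *\<^sub>R x) = c * p x)"

lemma sublinear_add: "sublinear p \<Longrightarrow> p (x + y) \<le> p x + p y"
  and sublinear_scale: "sublinear p \<Longrightarrow> 0 \<le> c \<Longrightarrow> p (c *\<^sub>R x) = c * p x"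
  by (auto simp: sublinear_def)

lemma sublinear_zero: "sublinear p \<Longrightarrow> p 0 = 0"
  using sublinear_scale[of p 0 0] by simp

lemma sublinear_minus: "sublinear p \<Longrightarrow> - p (- x) \<le> p x"
  using sublinear_add[of p x "- x"] sublinear_zero[of p] by simp

text \<open>Lowering \<open>p\<close> along the ray through \<open>v\<close> as far as sublinearity permits: the infimum of
  \<open>p (x + t v) - t p(v)\<close> over \<open>t \<ge> 0\<close> is finite because \<open>t p(v) = p (t v) \<le> p (x + t v) + p (- x)\<close>.
  The last conclusion forces every linear functional below \<open>q\<close> to take at least the value \<open>p v\<close> at \<open>v\<close>.\<close>
lemma sublinear_tilt:
  assumes p: "sublinear p"
  obtains q where "sublinear q" "\<And>x. q x \<le> p x" "q (- v) \<le> - p v"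
proof
  define S where "S x = {p (x + t *\<^sub>R v) - t * p v |t. 0 \<le> t}" for x
  define q where "q x = Inf (S x)" for x
  have low: "- p (- x) \<le> r" if r: "r \<in> S x" for x r
  proof -
    obtain t where t: "0 \<le> t" "r = p (x + t *\<^sub>R v) - t * p v" using r by (auto simp: S_def)
    have "p (t *\<^sub>R v) \<le> p (x + t *\<^sub>R v) + p (- x)"
      using sublinear_add[OF p, of "x + t *\<^sub>R v" "- x"] by simp
    then show ?thesis using t sublinear_scale[OF p] by simp
  qed
  then have bdd: "bdd_below (S x)" for x by (meson bdd_belowI)
  have ne: "S x \<noteq> {}" for x by (auto simp: S_def)
  have le: "q x \<le> p (x + t *\<^sub>R v) - t * p v" if "0 \<le> t" for x t
    unfolding q_def using that by (intro cInf_lower bdd) (auto simp: S_def)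
  show "q x \<le> p x" for x using le[of 0 x] by simp
  show "q (- v) \<le> - p v" using le[of 1 "- v"] sublinear_zero[OF p] by simp
  have ge: "r \<le> q x" if "\<And>t. 0 \<le> t \<Longrightarrow> r \<le> p (x + t *\<^sub>R v) - t * p v" for r x
    unfolding q_def using that by (intro cInf_greatest ne) (auto simp: S_def)
  have add: "q (x + y) \<le> q x + q y" for x y
  proof -
    have "q (x + y) - q y \<le> q x"
    proof (rule ge)
      fix s :: real assume s: "0 \<le> s"
      have "q (x + y) - (p (x + s *\<^sub>R v) - s * p v) \<le> q y"
      proof (rule ge)
        fix t :: real assume t: "0 \<le> t"
        have "q (x + y) \<le> p ((x + y) + (s + t) *\<^sub>R v) - (s + t) * p v"
          using le s t by simp
        also have "p ((x + y) + (s + t) *\<^sub>R v) \<le> p (x + s *\<^sub>R v) + p (y + t *\<^sub>R v)"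
          using sublinear_add[OF p, of "x + s *\<^sub>R v" "y + t *\<^sub>R v"] by (simp add: algebra_simps)
        finally show "q (x + y) - (p (x + s *\<^sub>R v) - s * p v) \<le> p (y + t *\<^sub>R v) - t * p v"
          by (simp add: algebra_simps)
      qed
      then show "q (x + y) - q y \<le> p (x + s *\<^sub>R v) - s * p v" by simp
    qed
    then show ?thesis by simp
  qed
  have scale_le: "q (c *\<^sub>R x) \<le> c * q x" if c: "0 < c" for c x
  proof -
    have "q (c *\<^sub>R x) / c \<le> q x"
    proof (rule ge)
      fix t :: real assume t: "0 \<le> t"
      have "q (c *\<^sub>R x) \<le> p (c *\<^sub>R x + (c * t) *\<^sub>R v) - (c * t) * p v" using le c t by simp
      also have "\<dots> = c * (p (x + t *\<^sub>R v) - t * p v)"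
        using sublinear_scale[OF p, of c "x + t *\<^sub>R v"] c by (simp add: algebra_simps)
      finally show "q (c *\<^sub>R x) / c \<le> p (x + t *\<^sub>R v) - t * p v"
        using c by (simp add: pos_divide_le_eq mult.commute)
    qed
    then show ?thesis using c by (simp add: pos_divide_le_eq mult.commute)
  qed
  have "q 0 = 0"
  proof (rule antisym)
    show "q 0 \<le> 0" using le[of 0 0] sublinear_zero[OF p] by simp
    show "0 \<le> q 0" by (rule ge) (simp add: sublinear_scale[OF p])
  qed
  moreover have "q (c *\<^sub>R x) = c * q x" if c: "0 < c" for c x
  proof (rule antisym[OF scale_le[OF c]])
    have "q ((1/c) *\<^sub>R (c *\<^sub>R x)) \<le> (1/c) * q (c *\<^sub>R x)" using scale_le[of "1/c" "c *\<^sub>R x"] c by simp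
    then show "c * q x \<le> q (c *\<^sub>R x)" using c by (simp add: pos_le_divide_eq mult.commute)
  qed
  ultimately have "q (c *\<^sub>R x) = c * q x" if "0 \<le> c" for c x
    using that by (cases "c = 0") auto
  with add show "sublinear q" by (auto simp: sublinear_def)
qed

text \<open>Along a chain of sublinear functionals below \<open>p\<close> the pointwise infimum is finite, since all of them
  are bounded below by \<open>- p (- x)\<close>, and it is subadditive because any two members have a common
  lower one in the chain. Hence Zorn's lemma applies.\<close>
lemma sublinear_minimal:
  fixes p :: "'a::real_vector \<Rightarrow> real"
  assumes p: "sublinear p"
  obtains m where "sublinear m" "\<And>x. m x \<le> p x"
    "\<And>q. sublinear q \<Longrightarrow> (\<And>x. q x \<le> m x) \<Longrightarrow> q = m"
proof -
  define A where "A = {q. sublinear q \<and> q \<le> p}"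
  define P where "P = (\<lambda>a b :: 'a \<Rightarrow> real. b \<le> a)"
  have po: "partial_order_on A (relation_of P A)"
    by (intro partial_order_on_relation_ofI) (auto simp: P_def)
  have "\<exists>u \<in> A. \<forall>a \<in> C. P a u" if C: "C \<in> Chains (relation_of P A)" for C
  proof (cases "C = {}")
    case True
    then show ?thesis using p by (auto simp: A_def)
  next
    case False
    have CA: "C \<subseteq> A" and tot: "\<And>a b. a \<in> C \<Longrightarrow> b \<in> C \<Longrightarrow> a \<le> b \<or> b \<le> a"
      using C unfolding Chains_def relation_of_def P_def by blast+
    have sub: "sublinear q" "q \<le> p" if "q \<in> C" for q using CA that by (auto simp: A_def)
    define u where "u x = (INF q\<in>C. q x)" for x
    have low: "- p (- x) \<le> q x" if "q \<in> C" for q x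
      using sublinear_minus[OF sub(1)[OF that], of x] le_funD[OF sub(2)[OF that], of "- x"] by linarith
    have bdd: "bdd_below ((\<lambda>q. q x) ` C)" for x
      using low by (intro bdd_belowI[of _ "- p (- x)"]) auto
    have le: "u x \<le> q x" if "q \<in> C" for q x
      unfolding u_def using that by (intro cINF_lower bdd)
    have ge: "r \<le> u x" if "\<And>q. q \<in> C \<Longrightarrow> r \<le> q x" for r x
      unfolding u_def using that False by (intro cINF_greatest) auto
    have "u (x + y) \<le> u x + u y" for x y
    proof -
      have "u (x + y) - u y \<le> u x"
      proof (rule ge)
        fix q assume q: "q \<in> C"
        have "u (x + y) - q x \<le> u y"
        proof (rule ge)
          fix r assume r: "r \<in> C"
          obtain s where s: "s \<in> C" "s \<le> q" "s \<le> r" using tot[OF q r] q r by auto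
          have "u (x + y) \<le> s x + s y"
            using le[OF s(1), of "x + y"] sublinear_add[OF sub(1)[OF s(1)], of x y] by linarith
          then show "u (x + y) - q x \<le> r y"
            using le_funD[OF s(2), of x] le_funD[OF s(3), of y] by linarith
        qed
        then show "u (x + y) - u y \<le> q x" by simp
      qed
      then show ?thesis by simp
    qed
    moreover have "u (c *\<^sub>R x) = c * u x" if c: "0 \<le> c" for c x
    proof (cases "c = 0")
      case True
      have "(\<lambda>q. q (0::'a)) ` C = {0}" using False sublinear_zero[OF sub(1)] by force
      then show ?thesis using True by (simp add: u_def)
    next
      case c0: False
      with c have c: "0 < c" by simp
      show ?thesis
      proof (rule antisym)
        have "u (c *\<^sub>R x) / c \<le> u x"
          using le[of _ "c *\<^sub>R x"] c sublinear_scale[OF sub(1), of _ c x]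
          by (intro ge) (simp add: pos_divide_le_eq mult.commute)
        then show "u (c *\<^sub>R x) \<le> c * u x" using c by (simp add: pos_divide_le_eq mult.commute)
        show "c * u x \<le> u (c *\<^sub>R x)"
        proof (rule ge)
          fix q assume "q \<in> C"
          then show "c * u x \<le> q (c *\<^sub>R x)"
            using mult_left_mono[OF le, of q c x] c sublinear_scale[OF sub(1), of q c x] by simp
        qed
      qed
    qed
    ultimately have "sublinear u" by (auto simp: sublinear_def)
    moreover obtain q where "q \<in> C" using False by auto
    then have "u \<le> p" using le sub(2) by (meson le_funI le_funD order_trans)
    ultimately show ?thesis using le by (auto simp: A_def P_def le_fun_def)
  qed
  from predicate_Zorn[OF po this] obtain m where m: "m \<in> A" "\<And>a. a \<in> A \<Longrightarrow> a \<le> m \<Longrightarrow> a = m"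
    unfolding P_def by blast
  show ?thesis
  proof
    show "sublinear m" "\<And>x. m x \<le> p x" using m(1) by (auto simp: A_def le_fun_def)
    fix q assume "sublinear q" "\<And>x. q x \<le> m x"
    then show "q = m" using m(1) by (intro m(2)) (auto simp: A_def le_fun_def intro: order_trans)
  qed
qed

text \<open>A minimal sublinear functional cannot be tilted any further, which makes it odd and hence linear.
  Tilting once along \<open>v\<close> before minimizing gives equality at the prescribed point.\<close>
theorem Hahn_Banach_sublinear:
  fixes p :: "'a::real_vector \<Rightarrow> real"
  assumes p: "sublinear p"
  obtains l where "linear l" "\<And>x. l x \<le> p x" "l v = p v"
proof -
  obtain q where q: "sublinear q" "\<And>x. q x \<le> p x" "q (- v) \<le> - p v"
    using sublinear_tilt[OF p] by metis
  obtain m where m: "sublinear m" "\<And>x. m x \<le> q x"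
    and min: "\<And>r. sublinear r \<Longrightarrow> (\<And>x. r x \<le> m x) \<Longrightarrow> r = m"
    using sublinear_minimal[OF q(1)] by metis
  have odd: "m (- x) = - m x" for x
  proof -
    obtain r where "sublinear r" "\<And>y. r y \<le> m y" "r (- x) \<le> - m x"
      using sublinear_tilt[OF m(1)] by metis
    with min have "m (- x) \<le> - m x" by metis
    with sublinear_minus[OF m(1), of x] show ?thesis by simp
  qed
  have "linear m"
  proof (rule linearI)
    fix x y
    show "m (x + y) = m x + m y"
      using sublinear_add[OF m(1), of x y] sublinear_add[OF m(1), of "- x" "- y"] odd[of x] odd[of y]
        odd[of "x + y"] by simp
  next
    fix c :: real and x
    show "m (c *\<^sub>R x) = c *\<^sub>R m x"
    proof (cases "0 \<le> c")
      case True
      then show ?thesis using sublinear_scale[OF m(1)] by simp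
    next
      case False
      then have "m ((- c) *\<^sub>R x) = (- c) * m x" using sublinear_scale[OF m(1), of "- c" x] by simp
      then show ?thesis using odd[of "c *\<^sub>R x"] by simp
    qed
  qed
  moreover have "m x \<le> p x" for x using m(2) q(2) order_trans by blast
  moreover have "m v = p v"
    using m(2)[of "- v"] q(3) odd[of v] \<open>m v \<le> p v\<close> by linarith
  ultimately show ?thesis using that by blast
qed

text \<open>Banach--Alaoglu, by Tychonoff's theorem: the values at \<open>x\<close> stay in the compact interval
  \<open>[- norm x, norm x]\<close>, so the family, seen in the product space, has a cluster point, and linearity
  passes to pointwise limits. The finer filter \<open>F\<close> plays the part of a
  subsequence: all limits known along \<open>G\<close> persist along it.\<close>
theorem weak_star_cluster_point:
  fixes \<zeta> :: "'i \<Rightarrow> ('y::real_normed_vector \<Rightarrow>\<^sub>L real)"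
  assumes G: "G \<noteq> bot" and bound: "\<forall>\<^sub>F i in G. norm (\<zeta> i) \<le> 1"
  obtains F z where "F \<le> G" "F \<noteq> bot"
    "\<And>x. ((\<lambda>i. blinfun_apply (\<zeta> i) x) \<longlongrightarrow> blinfun_apply z x) F"
proof -
  define U where "U = (\<Pi>\<^sub>E x\<in>(UNIV::'y set). {- norm x..norm x})"
  define H where "H = filtermap (\<lambda>i. blinfun_apply (\<zeta> i)) G"
  have "compactin euclidean U"
    unfolding U_def euclidean_product_topology[symmetric] compactin_PiE by auto
  then have "compact U" by simp
  moreover have "H \<noteq> bot" using G by (simp add: H_def filtermap_bot_iff)
  moreover have "eventually (\<lambda>g. g \<in> U) H"
    unfolding H_def eventually_filtermap
  proof (rule eventually_mono[OF bound])
    fix i assume i: "norm (\<zeta> i) \<le> 1"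
    have "\<bar>blinfun_apply (\<zeta> i) x\<bar> \<le> norm x" for x
      using norm_blinfun[of "\<zeta> i" x] mult_right_mono[OF i norm_ge_zero[of x]] by simp
    then show "blinfun_apply (\<zeta> i) \<in> U" by (auto simp: U_def abs_le_iff minus_le_iff)
  qed
  ultimately obtain g where g: "inf (nhds g) H \<noteq> bot"
    unfolding compact_filter by blast
  define F where "F = inf G (filtercomap (\<lambda>i. blinfun_apply (\<zeta> i)) (nhds g))"
  have F: "F \<le> G" by (simp add: F_def)
  have Fb: "F \<noteq> bot"
  proof
    assume "F = bot"
    then obtain P Q where PQ: "eventually P G"
        "eventually Q (filtercomap (\<lambda>i. blinfun_apply (\<zeta> i)) (nhds g))" "\<And>i. P i \<Longrightarrow> Q i \<Longrightarrow> False"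
      unfolding F_def trivial_limit_def eventually_inf by auto
    then obtain R where R: "eventually R (nhds g)" "\<And>i. R (blinfun_apply (\<zeta> i)) \<Longrightarrow> Q i"
      unfolding eventually_filtercomap by auto
    have "eventually (\<lambda>h. \<not> R h) H"
      unfolding H_def eventually_filtermap using PQ(1) by (rule eventually_mono) (use PQ R in blast)
    then have "inf (nhds g) H = bot"
      unfolding trivial_limit_def eventually_inf using R(1) by blast
    with g show False by simp
  qed
  have lim: "((\<lambda>i. blinfun_apply (\<zeta> i) x) \<longlongrightarrow> g x) F" for x
  proof -
    have "filterlim (\<lambda>i. blinfun_apply (\<zeta> i)) (nhds g) F"
      unfolding filterlim_iff_le_filtercomap by (simp add: F_def)
    then show ?thesis
      using continuous_on_tendsto_compose[OF continuous_on_product_coordinates[of x]] by simp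
  qed
  have "bounded_linear g"
  proof (rule bounded_linear_intro[where K = 1])
    show "g (x + y) = g x + g y" for x y
    proof (rule tendsto_unique[OF Fb lim])
      show "((\<lambda>i. blinfun_apply (\<zeta> i) (x + y)) \<longlongrightarrow> g x + g y) F"
        unfolding blinfun.add_right by (intro tendsto_add lim)
    qed
    show "g (c *\<^sub>R x) = c *\<^sub>R g x" for c x
    proof (rule tendsto_unique[OF Fb lim])
      show "((\<lambda>i. blinfun_apply (\<zeta> i) (c *\<^sub>R x)) \<longlongrightarrow> c *\<^sub>R g x) F"
        unfolding blinfun.scaleR_right by (intro tendsto_scaleR lim tendsto_const)
    qed
    show "norm (g x) \<le> norm x * 1" for x
    proof (rule tendsto_upperbound[OF tendsto_norm[OF lim[of x]] _ Fb])
      show "\<forall>\<^sub>F i in F. norm (blinfun_apply (\<zeta> i) x) \<le> norm x * 1"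
        using filter_leD[OF F bound]
      proof eventually_elim
        case (elim i)
        then show ?case using norm_blinfun[of "\<zeta> i" x] mult_right_mono[OF elim norm_ge_zero[of x]]
          by simp
      qed
    qed
  qed
  then have "blinfun_apply (Blinfun g) = g" by (rule bounded_linear_Blinfun_apply)
  with lim F Fb show ?thesis using that[of F "Blinfun g"] by simp
qed

text \<open>The sets \<open>S x = {y. F y + c dist y x \<le> F x}\<close> are nested along any sequence with
  \<open>x\<^sub>n\<^sub>+\<^sub>1 \<in> S x\<^sub>n\<close>, and they shrink to a point if \<open>x\<^sub>n\<^sub>+\<^sub>1\<close> almost minimizes \<open>F\<close> on
  \<open>S x\<^sub>n\<close>. A competitor violating the last conclusion at the limit \<open>u\<close> would lie in all of these sets, hence
  equal \<open>u\<close>.\<close>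
theorem Ekeland_variational_principle:
  fixes K :: "'v::complete_space set" and F :: "'v \<Rightarrow> real"
  assumes K: "closed K" and cont: "continuous_on K F" and nn: "\<And>u. u \<in> K \<Longrightarrow> 0 \<le> F u"
    and u0: "u0 \<in> K" and c: "0 < c"
  obtains u where "u \<in> K" "F u + c * dist u u0 \<le> F u0"
    "\<And>v. v \<in> K \<Longrightarrow> F u - c * dist v u \<le> F v"
proof -
  define S where "S x = {y \<in> K. F y + c * dist y x \<le> F x}" for x
  have self: "x \<in> S x" if "x \<in> K" for x using that by (simp add: S_def)
  have S_trans: "S y \<subseteq> S x" if "y \<in> S x" for x y
  proof
    fix w assume w: "w \<in> S y"
    have "c * dist w x \<le> c * dist w y + c * dist y x"
      using mult_left_mono[OF dist_triangle[of w x y], of c] c by (simp add: distrib_left)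
    then show "w \<in> S x" using w that unfolding S_def by auto
  qed
  have S_closed: "closed (S x)" for x
  proof -
    have "continuous_on K (\<lambda>y. F y + c * dist y x)" by (intro continuous_intros cont)
    from continuous_closed_preimage[OF this K closed_atMost[of "F x"]]
    show ?thesis by (simp add: S_def vimage_def Int_def)
  qed
  have step: "\<exists>y. y \<in> K \<and> (y \<in> S x \<and> (\<forall>w\<in>S x. F y \<le> F w + (1/2)^n))" if x: "x \<in> K" for x n
  proof -
    have bdd: "bdd_below (F ` S x)" using nn by (auto simp: S_def intro!: bdd_belowI[of _ 0])
    have "Inf (F ` S x) < Inf (F ` S x) + (1/2)^n" by simp
    then obtain y where y: "y \<in> S x" "F y < Inf (F ` S x) + (1/2)^n"
      using cInf_lessD[of "F ` S x"] self[OF x] by blast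
    then have "F y \<le> F w + (1/2)^n" if "w \<in> S x" for w
      using cInf_lower[OF imageI[OF that] bdd] by linarith
    then show ?thesis using y by (auto simp: S_def)
  qed
  from dependent_nat_choice[of "\<lambda>n x. x \<in> K \<and> (n = 0 \<longrightarrow> x = u0)"
      "\<lambda>n x y. y \<in> S x \<and> (\<forall>w\<in>S x. F y \<le> F w + (1/2)^n)"]
  obtain X where X: "\<And>n. X n \<in> K" "X 0 = u0" "\<And>n. X (Suc n) \<in> S (X n)"
    "\<And>n w. w \<in> S (X n) \<Longrightarrow> F (X (Suc n)) \<le> F w + (1/2)^n"
    using u0 step by (metis nat.distinct(1))
  have mono: "S (X n) \<subseteq> S (X m)" if "m \<le> n" for m n
    using that by (induction rule: dec_induct) (use X(3) S_trans in blast)+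
  have near: "c * dist w (X (Suc n)) \<le> (1/2)^n" if "w \<in> S (X (Suc n))" for w n
    using that X(4)[of w n] mono[of n "Suc n"] by (auto simp: S_def)
  have near0: "\<exists>n. \<forall>m\<ge>n. \<forall>w\<in>S (X m). dist w (X m) < e" if "0 < e" for e
  proof -
    have "0 < c * e" using c that by simp
    then obtain n where n: "(1/2)^n < c * e" using real_arch_pow_inv[of "c * e" "1/2"] by auto
    have "dist w (X m) < e" if m: "Suc n \<le> m" and w: "w \<in> S (X m)" for m w
    proof -
      obtain k where k: "m = Suc k" "n \<le> k" using m by (cases m) auto
      have "c * dist w (X m) \<le> (1/2)^k" using near w k by simp
      also have "\<dots> \<le> (1/2)^n" using k by (intro power_decreasing) auto
      finally have "c * dist w (X m) < c * e" using n by linarith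
      then show ?thesis using c by simp
    qed
    then show ?thesis by blast
  qed
  have Xin: "X n \<in> S (X m)" if "m \<le> n" for m n
    using mono[OF that] self[OF X(1)] by blast
  have "Cauchy X"
  proof (rule metric_CauchyI)
    fix e :: real assume "0 < e"
    then obtain n where n: "\<And>m w. m \<ge> n \<Longrightarrow> w \<in> S (X m) \<Longrightarrow> dist w (X m) < e/2"
      using near0[of "e/2"] by auto
    have "dist (X i) (X j) < e" if "n \<le> i" "n \<le> j" for i j
      using n[OF order_refl Xin[OF that(1)]] n[OF order_refl Xin[OF that(2)]]
      by (rule dist_triangle_half_l)
    then show "\<exists>M. \<forall>m\<ge>M. \<forall>n\<ge>M. dist (X m) (X n) < e" by blast
  qed
  then obtain u where u: "X \<longlonglongrightarrow> u" using Cauchy_convergent convergentD by blast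
  have uS: "u \<in> S (X m)" for m
    using Lim_in_closed_set[OF S_closed _ _ u] Xin eventually_ge_at_top[of m]
    by (metis (mono_tags, lifting) eventually_mono sequentially_bot)
  show ?thesis
  proof
    show "u \<in> K" "F u + c * dist u u0 \<le> F u0" using uS[of 0] X(2) by (auto simp: S_def)
    fix v assume v: "v \<in> K"
    show "F u - c * dist v u \<le> F v"
    proof (rule ccontr)
      assume neg: "\<not> F u - c * dist v u \<le> F v"
      then have "v \<in> S u" using v by (simp add: S_def)
      then have vS: "v \<in> S (X m)" for m using S_trans[OF uS] by blast
      have "X \<longlonglongrightarrow> v"
      proof (rule metric_LIMSEQ_I)
        fix r :: real assume "0 < r"
        then show "\<exists>no. \<forall>n\<ge>no. dist (X n) v < r" using near0[of r] vS by (metis dist_commute)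
      qed
      with u have "v = u" using LIMSEQ_unique by blast
      with neg show False by simp
    qed
  qed
qed

section \<open>The distance to a closed convex set\<close>

lemma convex_on_infdist:
  fixes Q :: "'y::real_normed_vector set"
  assumes Q: "convex Q" "Q \<noteq> {}"
  shows "convex_on UNIV (\<lambda>x. infdist x Q)"
proof (rule convex_onI)
  fix t :: real and x y :: 'y
  assume t: "0 < t" "t < 1"
  show "infdist ((1 - t) *\<^sub>R x + t *\<^sub>R y) Q \<le> (1 - t) * infdist x Q + t * infdist y Q"
  proof (rule field_le_epsilon)
    fix e :: real assume e: "0 < e"
    have "\<exists>q\<in>Q. dist z q < infdist z Q + e" for z
    proof -
      have "(INF q\<in>Q. dist z q) < infdist z Q + e" using e by (simp add: infdist_notempty[OF Q(2)])
      then show ?thesis using Q(2) cInf_lessD[of "dist z ` Q"] by blast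
    qed
    then obtain p q where p: "p \<in> Q" "dist x p < infdist x Q + e" and q: "q \<in> Q" "dist y q < infdist y Q + e"
      by metis
    have "infdist ((1 - t) *\<^sub>R x + t *\<^sub>R y) Q \<le> dist ((1 - t) *\<^sub>R x + t *\<^sub>R y) ((1 - t) *\<^sub>R p + t *\<^sub>R q)"
      using Q(1) p q t by (intro infdist_le) (simp add: convex_alt)
    also have "\<dots> = norm ((1 - t) *\<^sub>R (x - p) + t *\<^sub>R (y - q))"
      by (simp add: dist_norm algebra_simps)
    also have "\<dots> \<le> (1 - t) * dist x p + t * dist y q"
      using norm_triangle_ineq[of "(1 - t) *\<^sub>R (x - p)" "t *\<^sub>R (y - q)"] t by (simp add: dist_norm)
    also have "\<dots> \<le> (1 - t) * (infdist x Q + e) + t * (infdist y Q + e)"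
      using p q t by (intro add_mono mult_left_mono) auto
    finally show "infdist ((1 - t) *\<^sub>R x + t *\<^sub>R y) Q \<le> (1 - t) * infdist x Q + t * infdist y Q + e"
      by (simp add: algebra_simps)
  qed
qed simp

text \<open>For convex \<open>\<Phi>\<close> the difference quotients increase with \<open>t\<close>, so the one-sided derivative is their
  infimum; it is finite by the Lipschitz bound, and sublinearity is inherited from convexity in the limit.\<close>
lemma directional_derivative_sublinear:
  fixes \<Phi> :: "'y::real_normed_vector \<Rightarrow> real"
  assumes conv: "convex_on UNIV \<Phi>" and lip: "\<And>x y. \<bar>\<Phi> x - \<Phi> y\<bar> \<le> dist x y"
  obtains p where "sublinear p" "\<And>v. p v \<le> \<Phi> (y + v) - \<Phi> y"
    "\<And>v. ((\<lambda>t. (\<Phi> (y + t *\<^sub>R v) - \<Phi> y) / t) \<longlongrightarrow> p v) (at_right 0)"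
proof -
  define Qt where "Qt v t = (\<Phi> (y + t *\<^sub>R v) - \<Phi> y) / t" for v t
  define p where "p v = (INF t\<in>{0<..}. Qt v t)" for v
  have mono: "Qt v s \<le> Qt v t" if st: "0 < s" "s \<le> t" for v s t
  proof -
    have "\<Phi> ((1 - s/t) *\<^sub>R y + (s/t) *\<^sub>R (y + t *\<^sub>R v)) \<le> (1 - s/t) * \<Phi> y + (s/t) * \<Phi> (y + t *\<^sub>R v)"
      using st by (intro convex_onD[OF conv]) auto
    moreover have "(1 - s/t) *\<^sub>R y + (s/t) *\<^sub>R (y + t *\<^sub>R v) = y + s *\<^sub>R v"
      using st by (simp add: algebra_simps)
    ultimately have "\<Phi> (y + s *\<^sub>R v) - \<Phi> y \<le> s * Qt v t"
      using st by (simp add: Qt_def field_simps)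
    then show ?thesis using st by (simp add: Qt_def[of v s] pos_divide_le_eq mult.commute)
  qed
  have low: "- norm v \<le> Qt v t" if t: "0 < t" for v t
  proof -
    have "\<Phi> (y + t *\<^sub>R v) - \<Phi> y \<ge> - (t * norm v)"
      using lip[of "y + t *\<^sub>R v" y] t by (simp add: dist_norm)
    then show ?thesis using t by (simp add: Qt_def pos_le_divide_eq mult.commute)
  qed
  have le: "p v \<le> Qt v t" if "0 < t" for v t
    unfolding p_def using that low by (intro cINF_lower bdd_belowI[of _ "- norm v"]) auto
  have lim: "(Qt v \<longlongrightarrow> p v) (at_right 0)" for v
  proof (rule order_tendstoI)
    fix a assume a: "a < p v"
    have "a < Qt v t" if "t \<in> {0<..<1}" for t using le[of t v] a that by simp
    then show "\<forall>\<^sub>F t in at_right 0. a < Qt v t" using zero_less_one by (rule eventually_at_rightI)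
  next
    fix a assume "p v < a"
    then obtain t where t: "0 < t" "Qt v t < a"
      unfolding p_def using cInf_lessD[of "Qt v ` {0<..}"] by auto
    have "Qt v s < a" if "s \<in> {0<..<t}" for s using mono[of s t v] t that by simp
    then show "\<forall>\<^sub>F t in at_right 0. Qt v t < a" using t(1) by (rule eventually_at_rightI)
  qed
  have add: "p (v + w) \<le> p v + p w" for v w
  proof -
    have two: "filterlim (\<lambda>t::real. 2 * t) (at_right 0) (at_right 0)"
      using filterlim_times_pos[of "\<lambda>t::real. t" 0 "at_right 0" 2] by (simp add: filterlim_ident)
    have "\<forall>\<^sub>F t in at_right 0. Qt (v + w) t \<le> Qt v (2 * t) + Qt w (2 * t)"
    proof (rule eventually_at_rightI[of 0 1])
      fix t :: real assume "t \<in> {0<..<1}"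
      then have t: "0 < t" by simp
      have "\<Phi> ((1 - 1/2) *\<^sub>R (y + (2 * t) *\<^sub>R v) + (1/2) *\<^sub>R (y + (2 * t) *\<^sub>R w))
          \<le> (1 - 1/2) * \<Phi> (y + (2 * t) *\<^sub>R v) + (1/2) * \<Phi> (y + (2 * t) *\<^sub>R w)"
        by (intro convex_onD[OF conv]) auto
      moreover have "(1 - 1/2) *\<^sub>R (y + (2 * t) *\<^sub>R v) + (1/2) *\<^sub>R (y + (2 * t) *\<^sub>R w) = y + t *\<^sub>R (v + w)"
        by (simp add: algebra_simps flip: scaleR_add_left)
      ultimately have "\<Phi> (y + t *\<^sub>R (v + w)) - \<Phi> y
          \<le> ((\<Phi> (y + (2 * t) *\<^sub>R v) - \<Phi> y) + (\<Phi> (y + (2 * t) *\<^sub>R w) - \<Phi> y)) / 2"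
        by simp
      from divide_right_mono[OF this, of t] t
      show "Qt (v + w) t \<le> Qt v (2 * t) + Qt w (2 * t)"
        by (simp add: Qt_def flip: add_divide_distrib)
    qed simp
    from tendsto_le[OF _ tendsto_add[OF filterlim_compose[OF lim two] filterlim_compose[OF lim two]] lim this]
    show ?thesis by simp
  qed
  have scale: "p (c *\<^sub>R v) = c * p v" if c: "0 \<le> c" for c v
  proof (cases "c = 0")
    case True
    then show ?thesis by (simp add: p_def Qt_def)
  next
    case False
    with c have c: "0 < c" by simp
    have "filterlim (\<lambda>t. c * t) (at_right 0) (at_right 0)"
      using filterlim_times_pos[of "\<lambda>t. t" 0 "at_right 0" c] c by (simp add: filterlim_ident)
    from filterlim_compose[OF lim this]
    have "((\<lambda>t. c * Qt v (c * t)) \<longlongrightarrow> c * p v) (at_right 0)" by (intro tendsto_mult_left)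
    moreover have "(\<lambda>t. c * Qt v (c * t)) = Qt (c *\<^sub>R v)" using c by (auto simp: Qt_def mult.commute)
    ultimately show ?thesis using tendsto_unique[OF _ lim[of "c *\<^sub>R v"]] by simp
  qed
  have "sublinear p" using add scale by (auto simp: sublinear_def)
  moreover have "p v \<le> \<Phi> (y + v) - \<Phi> y" for v using le[of 1 v] by (simp add: Qt_def)
  ultimately show ?thesis using that lim unfolding Qt_def by blast
qed

definition subgradient :: "('y::real_normed_vector \<Rightarrow> real) \<Rightarrow> 'y \<Rightarrow> ('y \<Rightarrow>\<^sub>L real) \<Rightarrow> bool" where
  "subgradient \<Phi> y \<zeta> \<longleftrightarrow> (\<forall>v. blinfun_apply \<zeta> v \<le> \<Phi> (y + v) - \<Phi> y)"

lemma subgradient_norm_le_1: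
  assumes "subgradient \<Phi> y \<zeta>" and lip: "\<And>x y. \<bar>\<Phi> x - \<Phi> y\<bar> \<le> dist x y"
  shows "norm \<zeta> \<le> 1"
proof (rule norm_blinfun_bound)
  fix v
  have "blinfun_apply \<zeta> w \<le> norm w" for w
  proof -
    have "blinfun_apply \<zeta> w \<le> \<Phi> (y + w) - \<Phi> y" using assms(1) by (simp add: subgradient_def)
    also have "\<dots> \<le> norm w" using lip[of "y + w" y] by (simp add: dist_norm)
    finally show ?thesis .
  qed
  from this[of v] this[of "- v"] show "norm (blinfun_apply \<zeta> v) \<le> 1 * norm v"
    by (simp add: blinfun.minus_right abs_le_iff)
qed simp

text \<open>A functional below the directional derivative is a subgradient; Hahn--Banach provides one that
  agrees with the directional derivative in a given direction.\<close>
lemma subgradient_in_direction: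
  fixes \<Phi> :: "'y::real_normed_vector \<Rightarrow> real"
  assumes conv: "convex_on UNIV \<Phi>" and lip: "\<And>x y. \<bar>\<Phi> x - \<Phi> y\<bar> \<le> dist x y"
  obtains \<zeta> where "subgradient \<Phi> y \<zeta>"
    "((\<lambda>t. (\<Phi> (y + t *\<^sub>R v) - \<Phi> y) / t) \<longlongrightarrow> blinfun_apply \<zeta> v) (at_right 0)"
proof -
  obtain p where p: "sublinear p" "\<And>v. p v \<le> \<Phi> (y + v) - \<Phi> y"
    "\<And>v. ((\<lambda>t. (\<Phi> (y + t *\<^sub>R v) - \<Phi> y) / t) \<longlongrightarrow> p v) (at_right 0)"
    using directional_derivative_sublinear[OF conv lip, of y] by blast
  obtain l where l: "linear l" "\<And>x. l x \<le> p x" "l v = p v"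
    using Hahn_Banach_sublinear[OF p(1)] by metis
  have "l w \<le> norm w" for w
    using l(2)[of w] p(2)[of w] lip[of "y + w" y] by (simp add: dist_norm)
  from this this[of "- w" for w] have "norm (l w) \<le> norm w * 1" for w
    by (simp add: linear_neg[OF l(1)] abs_le_iff)
  then have "bounded_linear l"
    using l(1) by (intro bounded_linear_intro[where K = 1]) (auto simp: linear_add linear_scale)
  then have [simp]: "blinfun_apply (Blinfun l) = l" by (rule bounded_linear_Blinfun_apply)
  have "subgradient \<Phi> y (Blinfun l)"
    unfolding subgradient_def using l(2) p(2) by (auto intro: order_trans)
  then show ?thesis using that[of "Blinfun l"] p(3)[of v] l(3) by simp
qed

lemma subgradient_infdist_gap:
  assumes "subgradient (\<lambda>x. infdist x Q) y \<zeta>" "q \<in> Q"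
  shows "infdist y Q \<le> blinfun_apply \<zeta> (y - q)"
proof -
  have "blinfun_apply \<zeta> (q - y) \<le> infdist (y + (q - y)) Q - infdist y Q"
    using assms(1) unfolding subgradient_def by blast
  then show ?thesis using assms(2) by (simp add: blinfun.diff_right)
qed

text \<open>The Lipschitz constant gives norm at most one. For the converse, \<open>\<zeta>\<close> applied to \<open>y - q\<close>
  is at least the distance, while \<open>y - q\<close> can be chosen with norm arbitrarily close to it.\<close>
lemma subgradient_infdist_norm:
  assumes sg: "subgradient (\<lambda>x. infdist x Q) y \<zeta>" and Q: "closed Q" "Q \<noteq> {}" and y: "y \<notin> Q"
  shows "norm \<zeta> = 1"
proof (rule antisym)
  show "norm \<zeta> \<le> 1" by (rule subgradient_norm_le_1[OF sg infdist_triangle_abs])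
  define d where "d = infdist y Q"
  have d: "0 < d" using infdist_pos_not_in_closed[OF Q y] by (simp add: d_def)
  have le: "d \<le> norm \<zeta> * dist y q" if "q \<in> Q" for q
    using subgradient_infdist_gap[OF sg that] norm_blinfun[of \<zeta> "y - q"]
    by (simp add: d_def dist_norm)
  have pos: "0 < norm \<zeta>" using le d Q(2) by force
  have "d / norm \<zeta> \<le> d"
    unfolding d_def infdist_notempty[OF Q(2), of y] using Q(2) le pos
    by (intro cINF_greatest) (auto simp: d_def infdist_notempty pos_divide_le_eq mult.commute)
  then show "1 \<le> norm \<zeta>" using pos d by (simp add: pos_divide_le_eq)
qed

text \<open>The subgradients form a convex set that lies in the unit sphere of the dual, and a strictly convex
  sphere contains no segment.\<close>
lemma subgradient_infdist_unique:
  fixes Q :: "'y::banach set"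
  assumes sc: "strictly_convex_space TYPE('y \<Rightarrow>\<^sub>L real)"
    and Q: "closed Q" "Q \<noteq> {}" and y: "y \<notin> Q"
    and sg: "subgradient (\<lambda>x. infdist x Q) y \<zeta>1" "subgradient (\<lambda>x. infdist x Q) y \<zeta>2"
  shows "\<zeta>1 = \<zeta>2"
proof (rule ccontr)
  assume "\<zeta>1 \<noteq> \<zeta>2"
  then have "norm ((\<zeta>1 + \<zeta>2) /\<^sub>R 2) < 1"
    using sc sg subgradient_infdist_norm[OF _ Q y] unfolding strictly_convex_space_def by blast
  moreover have "subgradient (\<lambda>x. infdist x Q) y ((\<zeta>1 + \<zeta>2) /\<^sub>R 2)"
    unfolding subgradient_def
  proof
    fix v
    show "blinfun_apply ((\<zeta>1 + \<zeta>2) /\<^sub>R 2) v \<le> infdist (y + v) Q - infdist y Q"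
      using sg[unfolded subgradient_def, THEN spec[of _ v]]
      by (simp add: blinfun.add_left blinfun.scaleR_left)
  qed
  ultimately show False using subgradient_infdist_norm[OF _ Q y] by force
qed

text \<open>Every one-sided derivative is attained by some subgradient, and there is only one subgradient.
  A single \<open>\<zeta>\<close> for all directions matters: multipliers have to serve all
  elements of a nonconvex set of variations at once.\<close>
theorem infdist_Gateaux_differentiable:
  fixes Q :: "'y::banach set"
  assumes sc: "strictly_convex_space TYPE('y \<Rightarrow>\<^sub>L real)"
    and Q: "closed Q" "convex Q" "Q \<noteq> {}" and y: "y \<notin> Q"
  obtains \<zeta> where "subgradient (\<lambda>x. infdist x Q) y \<zeta>"
    "\<And>v. ((\<lambda>t. (infdist (y + t *\<^sub>R v) Q - infdist y Q) / t) \<longlongrightarrow> blinfun_apply \<zeta> v) (at_right 0)"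
proof -
  note dir = subgradient_in_direction[OF convex_on_infdist[OF Q(2,3)] infdist_triangle_abs]
  obtain \<zeta> where \<zeta>: "subgradient (\<lambda>x. infdist x Q) y \<zeta>" by (rule dir)
  show ?thesis
  proof (rule that[OF \<zeta>])
    fix v
    obtain \<eta> where \<eta>: "subgradient (\<lambda>x. infdist x Q) y \<eta>"
      "((\<lambda>t. (infdist (y + t *\<^sub>R v) Q - infdist y Q) / t) \<longlongrightarrow> blinfun_apply \<eta> v) (at_right 0)"
      by (rule dir)
    with subgradient_infdist_unique[OF sc Q(1,3) y \<zeta> \<eta>(1)]
    show "((\<lambda>t. (infdist (y + t *\<^sub>R v) Q - infdist y Q) / t) \<longlongrightarrow> blinfun_apply \<zeta> v) (at_right 0)" by simp
  qed
qed

text \<open>The Lipschitz bound allows replacing \<open>g (e\<^sub>k)\<close> by \<open>g u + h\<^sub>k \<xi>\<close> up to an error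
  \<open>o(h\<^sub>k)\<close>, so the slope bound at \<open>u\<close> passes to the directional derivative of
  \<open>\<Phi>\<close>.\<close>
lemma variation_derivative_ge:
  fixes g :: "'v::metric_space \<Rightarrow> 'y::banach" and \<Phi> :: "'y \<Rightarrow> real"
  assumes lip: "\<And>x y. \<bar>\<Phi> x - \<Phi> y\<bar> \<le> dist x y"
    and der: "((\<lambda>t. (\<Phi> (g u + t *\<^sub>R \<xi>) - \<Phi> (g u)) / t) \<longlongrightarrow> D) (at_right 0)"
    and \<xi>: "\<xi> \<in> variation K g u" and c: "0 \<le> c"
    and slope: "\<And>v. v \<in> K \<Longrightarrow> \<Phi> (g u) - c * dist v u \<le> \<Phi> (g v)"
  shows "- c \<le> D"
proof -
  obtain h e where h: "\<And>k. 0 < h k" "h \<longlonglongrightarrow> 0" and e: "\<And>k. e k \<in> K" "\<And>k. dist (e k) u \<le> h k"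
    and lim: "(\<lambda>k. (g (e k) - g u) /\<^sub>R h k) \<longlonglongrightarrow> \<xi>"
    using \<xi> unfolding variation_def by blast
  define q where "q k = (\<Phi> (g u + h k *\<^sub>R \<xi>) - \<Phi> (g u)) / h k" for k
  have "filterlim h (at_right 0) sequentially"
    using h by (simp add: filterlim_at less_imp_neq[symmetric] always_eventually)
  from filterlim_compose[OF der this] have "q \<longlonglongrightarrow> D" by (simp add: q_def[abs_def])
  moreover have "(\<lambda>k. norm ((g (e k) - g u) /\<^sub>R h k - \<xi>)) \<longlonglongrightarrow> 0"
    using lim by (simp add: tendsto_norm_zero_iff LIM_zero_iff)
  ultimately have "(\<lambda>k. q k + norm ((g (e k) - g u) /\<^sub>R h k - \<xi>)) \<longlonglongrightarrow> D + 0" by (intro tendsto_add)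
  moreover have "- c \<le> q k + norm ((g (e k) - g u) /\<^sub>R h k - \<xi>)" for k
  proof -
    have "\<Phi> (g (e k)) - \<Phi> (g u + h k *\<^sub>R \<xi>) \<le> norm (g (e k) - g u - h k *\<^sub>R \<xi>)"
      using lip[of "g (e k)" "g u + h k *\<^sub>R \<xi>"] by (simp add: dist_norm diff_diff_eq)
    also have "g (e k) - g u - h k *\<^sub>R \<xi> = h k *\<^sub>R ((g (e k) - g u) /\<^sub>R h k - \<xi>)"
      using h(1)[of k] by (simp add: algebra_simps)
    finally have "\<Phi> (g (e k)) - \<Phi> (g u + h k *\<^sub>R \<xi>) \<le> h k * norm ((g (e k) - g u) /\<^sub>R h k - \<xi>)"
      using h(1)[of k] by simp
    moreover have "\<Phi> (g u) - c * h k \<le> \<Phi> (g (e k))"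
      using slope[OF e(1)[of k]] mult_left_mono[OF e(2)[of k] c] by linarith
    moreover have "\<Phi> (g u + h k *\<^sub>R \<xi>) - \<Phi> (g u) = h k * q k" using h(1)[of k] by (simp add: q_def)
    ultimately have "h k * (- c) \<le> h k * (q k + norm ((g (e k) - g u) /\<^sub>R h k - \<xi>))"
      by (simp add: algebra_simps)
    then show ?thesis using h(1)[of k] by (rule mult_left_le_imp_le)
  qed
  ultimately show ?thesis using tendsto_lowerbound[of _ "D + 0" sequentially "- c"] by simp
qed

section \<open>The dual of \<open>real \<times> 'x\<close>\<close>

text \<open>Functionals on \<open>real \<times> 'x\<close> are pairs of a number, the value at \<open>(1, 0)\<close>, and
  an element of the dual of \<open>'x\<close>, which this extracts.\<close>
definition dual_snd :: "((real \<times> 'x::real_normed_vector) \<Rightarrow>\<^sub>L real) \<Rightarrow> ('x \<Rightarrow>\<^sub>L real)" where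
  "dual_snd \<zeta> = \<zeta> o\<^sub>L Blinfun (\<lambda>x. (0, x))"

lemma dual_snd_apply: "blinfun_apply (dual_snd \<zeta>) x = blinfun_apply \<zeta> (0, x)"
proof -
  have "bounded_linear (\<lambda>x::'a. (0::real, x))"
    by (intro bounded_linear_Pair bounded_linear_zero bounded_linear_ident)
  then show ?thesis by (simp add: dual_snd_def bounded_linear_Blinfun_apply)
qed

lemma dual_prod_apply:
  "blinfun_apply \<zeta> (s, x) = s * blinfun_apply \<zeta> (1, 0) + blinfun_apply (dual_snd \<zeta>) x"
proof -
  have "(s, x) = s *\<^sub>R (1, 0) + (0, x)" by simp
  then show ?thesis
    by (simp add: blinfun.add_right blinfun.scaleR_right dual_snd_apply del: scaleR_Pair add_Pair)
qed

text \<open>The product norm is Euclidean, hence so is the dual norm. One inequality is Cauchy--Schwarz; the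
  other comes from testing \<open>\<zeta>\<close> with the vector \<open>(a |x|\<^sup>2, z(x) x)\<close>, which is proportional to the
  maximizer among vectors whose second component is parallel to \<open>x\<close>.\<close>
lemma norm_dual_prod:
  fixes \<zeta> :: "(real \<times> 'x::real_normed_vector) \<Rightarrow>\<^sub>L real"
  shows "(norm \<zeta>)\<^sup>2 = (blinfun_apply \<zeta> (1, 0))\<^sup>2 + (norm (dual_snd \<zeta>))\<^sup>2"
proof -
  define a z where "a = blinfun_apply \<zeta> (1, 0)" and "z = dual_snd \<zeta>"
  have app: "blinfun_apply \<zeta> (s, x) = s * a + blinfun_apply z x" for s x
    by (simp add: dual_prod_apply[of \<zeta> s x] a_def z_def)
  have "norm \<zeta> \<le> sqrt (a\<^sup>2 + (norm z)\<^sup>2)"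
  proof (rule norm_blinfun_bound)
    fix v :: "real \<times> 'x"
    obtain s x where v: "v = (s, x)" by (cases v)
    have "norm (blinfun_apply \<zeta> v) \<le> \<bar>s\<bar> * \<bar>a\<bar> + norm z * norm x"
      unfolding v app real_norm_def using norm_blinfun[of z x] abs_triangle_ineq[of "s * a" "blinfun_apply z x"]
      by (simp add: abs_mult)
    also have "\<dots> = inner (\<bar>a\<bar>, norm z) (\<bar>s\<bar>, norm x)" by simp
    also have "\<dots> \<le> sqrt (a\<^sup>2 + (norm z)\<^sup>2) * norm v"
      using norm_cauchy_schwarz[of "(\<bar>a\<bar>, norm z)" "(\<bar>s\<bar>, norm x)"] by (simp add: v norm_Pair)
    finally show "norm (blinfun_apply \<zeta> v) \<le> sqrt (a\<^sup>2 + (norm z)\<^sup>2) * norm v" .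
  qed simp
  from power_mono[OF this norm_ge_zero, of 2] have "(norm \<zeta>)\<^sup>2 \<le> a\<^sup>2 + (norm z)\<^sup>2"
    by simp
  moreover have "a\<^sup>2 + (norm z)\<^sup>2 \<le> (norm \<zeta>)\<^sup>2"
  proof -
    have "\<bar>a\<bar> \<le> norm \<zeta>" using norm_blinfun[of \<zeta> "(1, 0)"] by (simp add: a_def norm_Pair)
    then have aN: "a\<^sup>2 \<le> (norm \<zeta>)\<^sup>2" by (simp add: abs_le_square_iff[symmetric])
    have "norm z \<le> sqrt ((norm \<zeta>)\<^sup>2 - a\<^sup>2)"
    proof (rule norm_blinfun_bound)
      fix x
      define t where "t = blinfun_apply z x"
      define S where "S = a\<^sup>2 * (norm x)\<^sup>2 + t\<^sup>2"
      have S0: "0 \<le> S" by (simp add: S_def)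
      have "S = blinfun_apply \<zeta> (a * (norm x)\<^sup>2, t *\<^sub>R x)"
        unfolding app S_def t_def blinfun.scaleR_right power2_eq_square by (simp add: mult_ac)
      also have "\<dots> \<le> norm \<zeta> * norm (a * (norm x)\<^sup>2, t *\<^sub>R x)"
        using norm_blinfun[of \<zeta> "(a * (norm x)\<^sup>2, t *\<^sub>R x)"] by simp
      also have "norm (a * (norm x)\<^sup>2, t *\<^sub>R x) = sqrt ((norm x)\<^sup>2 * S)"
        by (simp add: norm_Pair S_def power2_eq_square algebra_simps)
      finally have "S\<^sup>2 \<le> (norm \<zeta> * sqrt ((norm x)\<^sup>2 * S))\<^sup>2" using S0 by (rule power_mono)
      then have "S * S \<le> S * ((norm \<zeta>)\<^sup>2 * (norm x)\<^sup>2)"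
        using S0 by (simp add: power_mult_distrib power2_eq_square mult_ac)
      then have "S \<le> (norm \<zeta>)\<^sup>2 * (norm x)\<^sup>2"
        using S0 by (cases "S = 0") auto
      then have "t\<^sup>2 \<le> ((norm \<zeta>)\<^sup>2 - a\<^sup>2) * (norm x)\<^sup>2" by (simp add: S_def algebra_simps)
      then have "sqrt (t\<^sup>2) \<le> sqrt (((norm \<zeta>)\<^sup>2 - a\<^sup>2) * (norm x)\<^sup>2)" by (rule real_sqrt_le_mono)
      then show "norm (blinfun_apply z x) \<le> sqrt ((norm \<zeta>)\<^sup>2 - a\<^sup>2) * norm x"
        by (simp add: t_def real_sqrt_mult)
    qed (use aN in simp)
    from power_mono[OF this norm_ge_zero, of 2] aN show ?thesis by simp
  qed
  ultimately show ?thesis by (simp add: a_def z_def)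
qed

text \<open>If the midpoint of two unit functionals has norm at least one, strict convexity of the Euclidean plane, applied to
  the pairs formed by the first component and the norm of the second, makes the first components equal and the second components
  equal in norm; strict convexity of the dual of \<open>'x\<close> then identifies the latter.\<close>
lemma strictly_convex_dual_prod:
  assumes sc: "strictly_convex_space TYPE('x::banach \<Rightarrow>\<^sub>L real)"
  shows "strictly_convex_space TYPE((real \<times> 'x) \<Rightarrow>\<^sub>L real)"
  unfolding strictly_convex_space_def
proof (intro allI impI, elim conjE)
  fix \<zeta> \<eta> :: "(real \<times> 'x) \<Rightarrow>\<^sub>L real"
  assume n: "norm \<zeta> = 1" "norm \<eta> = 1" and ne: "\<zeta> \<noteq> \<eta>"
  define a b where "a = blinfun_apply \<zeta> (1, 0)" and "b = blinfun_apply \<eta> (1, 0)"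
  define z w where "z = dual_snd \<zeta>" and "w = dual_snd \<eta>"
  define m where "m = (\<zeta> + \<eta>) /\<^sub>R 2"
  have unit: "a\<^sup>2 + (norm z)\<^sup>2 = 1" "b\<^sup>2 + (norm w)\<^sup>2 = 1"
    using norm_dual_prod[of \<zeta>] norm_dual_prod[of \<eta>] n by (simp_all add: a_def b_def z_def w_def)
  have "dual_snd m = (z + w) /\<^sub>R 2"
    by (rule blinfun_eqI) (simp add: m_def z_def w_def dual_snd_apply blinfun.add_left blinfun.scaleR_left)
  moreover have "blinfun_apply m (1, 0) = (a + b) / 2"
    by (simp add: m_def a_def b_def blinfun.add_left blinfun.scaleR_left)
  ultimately have m: "(norm m)\<^sup>2 = ((a + b) / 2)\<^sup>2 + (norm ((z + w) /\<^sub>R 2))\<^sup>2"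
    using norm_dual_prod[of m] by presburger
  show "norm m < 1"
  proof (rule ccontr)
    assume "\<not> norm m < 1"
    then have "1\<^sup>2 \<le> (norm m)\<^sup>2" by (intro power_mono) auto
    then have big: "1 \<le> ((a + b) / 2)\<^sup>2 + (norm ((z + w) /\<^sub>R 2))\<^sup>2" using m by simp
    have "norm ((z + w) /\<^sub>R 2) \<le> (norm z + norm w) / 2"
      using norm_triangle_ineq[of z w] by simp
    then have "(norm ((z + w) /\<^sub>R 2))\<^sup>2 \<le> ((norm z + norm w) / 2)\<^sup>2" by (intro power_mono) auto
    with big have "1 \<le> ((a + b) / 2)\<^sup>2 + ((norm z + norm w) / 2)\<^sup>2" by linarith
    also have "\<dots> = (a\<^sup>2 + (norm z)\<^sup>2 + (b\<^sup>2 + (norm w)\<^sup>2)) / 2 - ((a - b)\<^sup>2 + (norm z - norm w)\<^sup>2) / 4"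
      by (simp add: power2_eq_square field_simps)
    finally have "(a - b)\<^sup>2 + (norm z - norm w)\<^sup>2 \<le> 0" using unit by simp
    then have ab: "a = b" and zw: "norm z = norm w"
      by (simp_all add: sum_power2_le_zero_iff)
    have "z \<noteq> w"
    proof
      assume "z = w"
      then have "blinfun_apply \<zeta> v = blinfun_apply \<eta> v" for v
        using ab dual_prod_apply[of \<zeta> "fst v" "snd v"] dual_prod_apply[of \<eta> "fst v" "snd v"]
        by (simp add: a_def b_def z_def w_def)
      with ne show False by (simp add: blinfun_eqI)
    qed
    define r where "r = norm z"
    have r: "0 < r" using \<open>z \<noteq> w\<close> zw by (auto simp: r_def)
    have "norm ((z /\<^sub>R r + w /\<^sub>R r) /\<^sub>R 2) < 1"
      using sc r \<open>z \<noteq> w\<close> zw unfolding strictly_convex_space_def by (simp add: r_def)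
    also have "(z /\<^sub>R r + w /\<^sub>R r) /\<^sub>R 2 = ((z + w) /\<^sub>R 2) /\<^sub>R r"
      by (simp add: scaleR_add_right mult.commute)
    finally have "norm ((z + w) /\<^sub>R 2) / r < 1" using r by (simp only: norm_scaleR) (simp add: field_simps)
    then have "norm ((z + w) /\<^sub>R 2) < r" using r by (simp only: pos_divide_less_eq mult_1)
    then have "(norm ((z + w) /\<^sub>R 2))\<^sup>2 < r\<^sup>2" by (intro power_strict_mono) auto
    with big unit(1) ab show False by (simp add: r_def)
  qed
qed

section \<open>Weak-star null families bounded below on a finite codimensional set\<close>

lemma subspace_closure:
  fixes S :: "'a::real_normed_vector set"
  assumes S: "subspace S"
  shows "subspace (closure S)"
  unfolding subspace_def
proof (intro conjI ballI allI)
  show "0 \<in> closure S" using S closure_subset subspace_0 by blast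
next
  fix x y assume "x \<in> closure S" "y \<in> closure S"
  then obtain p q where pq: "\<And>n. p n \<in> S" "p \<longlonglongrightarrow> x" "\<And>n. q n \<in> S" "q \<longlonglongrightarrow> y"
    unfolding closure_sequential by blast
  then have "\<And>n. p n + q n \<in> S" "(\<lambda>n. p n + q n) \<longlonglongrightarrow> x + y"
    by (auto intro: subspace_add[OF S] tendsto_add)
  then show "x + y \<in> closure S" unfolding closure_sequential by (intro exI conjI allI)
next
  fix c :: real and x assume "x \<in> closure S"
  then obtain p where p: "\<And>n. p n \<in> S" "p \<longlonglongrightarrow> x"
    unfolding closure_sequential by blast
  then have "\<And>n. c *\<^sub>R p n \<in> S" "(\<lambda>n. c *\<^sub>R p n) \<longlonglongrightarrow> c *\<^sub>R x"
    by (auto intro: subspace_scale[OF S] tendsto_intros)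
  then show "c *\<^sub>R x \<in> closure S" unfolding closure_sequential by (intro exI conjI allI)
qed

text \<open>Uniform convergence to zero on the unit ball of a subspace extends to its closure. If \<open>x\<close> has
  distance \<open>d > 0\<close> from that closure, the coefficient of \<open>x\<close> in a vector \<open>v\<close> is at most
  \<open>norm v / d\<close>, so pointwise convergence at \<open>x\<close> is enough to add this direction.\<close>
lemma vanishing_span_insert:
  fixes \<zeta> :: "'i \<Rightarrow> ('x::real_normed_vector \<Rightarrow>\<^sub>L real)"
  assumes lim: "((\<lambda>i. blinfun_apply (\<zeta> i) x) \<longlongrightarrow> 0) F"
    and s: "(s \<longlongrightarrow> 0) F" "\<forall>\<^sub>F i in F. \<forall>v\<in>span S. \<bar>blinfun_apply (\<zeta> i) v\<bar> \<le> s i * norm v"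
  obtains s' where "(s' \<longlongrightarrow> 0) F"
    "\<forall>\<^sub>F i in F. \<forall>v\<in>span (insert x S). \<bar>blinfun_apply (\<zeta> i) v\<bar> \<le> s' i * norm v"
proof -
  define M where "M = closure (span S)"
  have M: "closed M" "M \<noteq> {}" "subspace M"
    using span_zero[of S] by (auto simp: M_def subspace_closure)
  have clo: "\<forall>v\<in>M. \<bar>blinfun_apply (\<zeta> i) v\<bar> \<le> s i * norm v"
    if "\<forall>v\<in>span S. \<bar>blinfun_apply (\<zeta> i) v\<bar> \<le> s i * norm v" for i
  proof -
    have "closed {v. \<bar>blinfun_apply (\<zeta> i) v\<bar> \<le> s i * norm v}"
      by (intro closed_Collect_le continuous_intros)
    then have "M \<subseteq> {v. \<bar>blinfun_apply (\<zeta> i) v\<bar> \<le> s i * norm v}"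
      unfolding M_def using that by (intro closure_minimal) auto
    then show ?thesis by auto
  qed
  show ?thesis
  proof (cases "x \<in> M")
    case True
    have "span (insert x S) \<subseteq> M"
      using True M(3) span_superset[of S] closure_subset[of "span S"]
      by (intro span_minimal) (auto simp: M_def)
    then show ?thesis using s clo by (intro that[of s]) (auto elim!: eventually_mono)
  next
    case False
    define d where "d = infdist x M"
    have d: "0 < d" using infdist_pos_not_in_closed[OF M(1,2) False] by (simp add: d_def)
    define s' where "s' i = \<bar>s i\<bar> * (1 + norm x / d) + \<bar>blinfun_apply (\<zeta> i) x\<bar> / d" for i
    have "((\<lambda>i. \<bar>s i\<bar> * (1 + norm x / d) + \<bar>blinfun_apply (\<zeta> i) x\<bar> / d) \<longlongrightarrow> \<bar>0\<bar> * (1 + norm x / d) + \<bar>0\<bar> / d) F"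
      using d by (intro tendsto_intros s lim) auto
    then have "(s' \<longlongrightarrow> 0) F" by (simp add: s'_def[abs_def])
    moreover have "\<forall>\<^sub>F i in F. \<forall>v\<in>span (insert x S). \<bar>blinfun_apply (\<zeta> i) v\<bar> \<le> s' i * norm v"
      using s(2)
    proof eventually_elim
      case (elim i)
      show ?case
      proof
        fix v assume "v \<in> span (insert x S)"
        then obtain k where k: "v - k *\<^sub>R x \<in> span S" by (auto simp: span_breakdown_eq)
        define m where "m = v - k *\<^sub>R x"
        have kd: "\<bar>k\<bar> \<le> norm v / d"
        proof (cases "k = 0")
          case True
          then show ?thesis using d by simp
        next
          case k0: False
          have "- (1/k) *\<^sub>R m \<in> M"
            using k closure_subset[of "span S"] M(3) unfolding m_def M_def
            by (intro subspace_scale) auto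
          then have "d \<le> dist x (- (1/k) *\<^sub>R m)" unfolding d_def by (rule infdist_le)
          also have "\<dots> = norm ((1/k) *\<^sub>R v)" using k0 by (simp add: dist_norm m_def algebra_simps)
          also have "\<dots> = norm v / \<bar>k\<bar>" by simp
          finally show ?thesis using k0 d by (simp add: field_simps)
        qed
        have "norm m \<le> norm v + \<bar>k\<bar> * norm x"
          unfolding m_def using norm_triangle_ineq4[of v "k *\<^sub>R x"] by simp
        also have "\<dots> \<le> norm v + (norm v / d) * norm x"
          using kd by (intro add_left_mono mult_right_mono) auto
        finally have nm: "norm m \<le> (1 + norm x / d) * norm v" by (simp add: algebra_simps)
        have "\<bar>blinfun_apply (\<zeta> i) v\<bar> = \<bar>blinfun_apply (\<zeta> i) m + k * blinfun_apply (\<zeta> i) x\<bar>"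
          by (simp add: m_def blinfun.diff_right blinfun.scaleR_right)
        also have "\<dots> \<le> \<bar>s i\<bar> * norm m + \<bar>k\<bar> * \<bar>blinfun_apply (\<zeta> i) x\<bar>"
          using elim k mult_right_mono[OF abs_ge_self[of "s i"] norm_ge_zero[of m]]
          by (auto simp: m_def abs_mult intro!: order_trans[OF abs_triangle_ineq] intro: order_trans)
        also have "\<dots> \<le> \<bar>s i\<bar> * ((1 + norm x / d) * norm v) + (norm v / d) * \<bar>blinfun_apply (\<zeta> i) x\<bar>"
          using nm kd by (intro add_mono mult_left_mono mult_right_mono) auto
        also have "\<dots> = s' i * norm v" by (simp add: s'_def algebra_simps)
        finally show "\<bar>blinfun_apply (\<zeta> i) v\<bar> \<le> s' i * norm v" .
      qed
    qed
    ultimately show ?thesis by (rule that)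
  qed
qed

text \<open>In general a weak-star null family need not be norm null. Here the bound from below on \<open>D\<close> extends
  to the closed convex hull of \<open>D\<close>, a translate of which contains a ball of its closed span \<open>L\<close>. The values at the
  centre of this ball tend to zero, and by its symmetry the bound becomes two-sided, so the norms on \<open>L\<close>
  tend to zero. The finitely
  many remaining directions are added one at a time.\<close>
theorem finite_codim_imp_norm_tendsto_0:
  fixes \<zeta> :: "'i \<Rightarrow> ('x::banach \<Rightarrow>\<^sub>L real)"
  assumes D: "finite_codim D"
    and lim: "\<And>x. ((\<lambda>i. blinfun_apply (\<zeta> i) x) \<longlongrightarrow> 0) F"
    and \<sigma>: "(\<sigma> \<longlongrightarrow> 0) F" "\<forall>\<^sub>F i in F. \<forall>x\<in>D. - \<sigma> i \<le> blinfun_apply (\<zeta> i) x"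
  shows "((\<lambda>i. norm (\<zeta> i)) \<longlongrightarrow> 0) F"
proof -
  obtain x0 where x0: "finite_codim_subspace (closure (span ((\<lambda>x. x - x0) ` D)))"
      "(top_of_set (closure (span ((\<lambda>x. x - x0) ` D)))) interior_of
         (closure (convex hull ((\<lambda>x. x - x0) ` D))) \<noteq> {}"
    using D unfolding finite_codim_def Let_def by blast
  define D0 where "D0 = (\<lambda>x. x - x0) ` D"
  define L where "L = closure (span D0)"
  have L: "subspace L" "closed L" by (auto simp: L_def subspace_closure)
  obtain B where B: "finite B" "{x + y |x y. x \<in> closure L \<and> y \<in> span B} = UNIV"
    using x0(1) unfolding finite_codim_subspace_def L_def D0_def by blast
  obtain c T where T: "openin (top_of_set L) T" "c \<in> T" "T \<subseteq> closure (convex hull D0)"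
    using x0(2) unfolding interior_of_def L_def D0_def by blast
  then obtain e where e: "0 < e" "ball c e \<inter> L \<subseteq> T" and c: "c \<in> L"
    unfolding openin_contains_ball by blast
  define \<tau> where "\<tau> i = (2 / e) * (\<sigma> i + blinfun_apply (\<zeta> i) x0 + blinfun_apply (\<zeta> i) c)" for i
  have "((\<lambda>i. (2 / e) * (\<sigma> i + blinfun_apply (\<zeta> i) x0 + blinfun_apply (\<zeta> i) c)) \<longlongrightarrow> (2 / e) * (0 + 0 + 0)) F"
    by (intro tendsto_intros \<sigma> lim)
  then have \<tau>: "(\<tau> \<longlongrightarrow> 0) F" by (simp add: \<tau>_def[abs_def])
  have onL: "\<forall>\<^sub>F i in F. \<forall>v\<in>span L. \<bar>blinfun_apply (\<zeta> i) v\<bar> \<le> \<tau> i * norm v"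
    using \<sigma>(2)
  proof eventually_elim
    case (elim i)
    \<comment> \<open>The lower bound on \<open>D0\<close>, written as a closed half-space.\<close>
    define H where "H = {y. - \<sigma> i - blinfun_apply (\<zeta> i) x0 \<le> blinfun_apply (\<zeta> i) y}"
    have "convex H"
      unfolding H_def convex_def
    proof (clarsimp simp: blinfun.add_right blinfun.scaleR_right)
      fix x y and u v :: real
      assume a: "- \<sigma> i - blinfun_apply (\<zeta> i) x0 \<le> blinfun_apply (\<zeta> i) x"
        "- \<sigma> i - blinfun_apply (\<zeta> i) x0 \<le> blinfun_apply (\<zeta> i) y" "0 \<le> u" "0 \<le> v" "u + v = 1"
      show "- \<sigma> i - blinfun_apply (\<zeta> i) x0 \<le> u * blinfun_apply (\<zeta> i) x + v * blinfun_apply (\<zeta> i) y"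
        using convex_bound_le[of "- blinfun_apply (\<zeta> i) x" "\<sigma> i + blinfun_apply (\<zeta> i) x0"
            "- blinfun_apply (\<zeta> i) y" u v] a by (simp add: algebra_simps)
    qed
    moreover have "closed H" unfolding H_def by (intro closed_Collect_le continuous_intros)
    moreover have "D0 \<subseteq> H" using elim by (auto simp: D0_def H_def blinfun.diff_right)
    ultimately have "closure (convex hull D0) \<subseteq> H" by (intro closure_minimal hull_minimal)
    then have TH: "y \<in> T \<Longrightarrow> - \<sigma> i - blinfun_apply (\<zeta> i) x0 \<le> blinfun_apply (\<zeta> i) y" for y
      using T(3) by (auto simp: H_def)
    have "\<bar>blinfun_apply (\<zeta> i) v\<bar> \<le> \<tau> i * norm v" if v: "v \<in> L" for v
    proof (cases "v = 0")
      case False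
      \<comment> \<open>With this factor \<open>c + k v\<close> and \<open>c - k v\<close> stay in the ball around \<open>c\<close>.\<close>
      define k where "k = e / (2 * norm v)"
      have k: "0 < k" using False e by (simp add: k_def)
      have half: "c + r *\<^sub>R v \<in> T" if "\<bar>r\<bar> = k" for r
      proof -
        have "norm (r *\<^sub>R v) = e / 2" using False that by (simp add: k_def)
        then have "c + r *\<^sub>R v \<in> ball c e" using e by (simp add: dist_norm)
        moreover have "c + r *\<^sub>R v \<in> L" using c v L by (simp add: subspace_add subspace_scale)
        ultimately show ?thesis using e by blast
      qed
      have "k * \<bar>blinfun_apply (\<zeta> i) v\<bar> \<le> \<sigma> i + blinfun_apply (\<zeta> i) x0 + blinfun_apply (\<zeta> i) c"
        using TH[OF half[of k]] TH[OF half[of "- k"]] k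
        by (cases "0 \<le> blinfun_apply (\<zeta> i) v")
          (simp_all add: blinfun.add_right blinfun.scaleR_right blinfun.diff_right)
      then have "\<bar>blinfun_apply (\<zeta> i) v\<bar> \<le> (\<sigma> i + blinfun_apply (\<zeta> i) x0 + blinfun_apply (\<zeta> i) c) / k"
        using k by (simp add: pos_le_divide_eq mult.commute)
      also have "\<dots> = \<tau> i * norm v" using False e by (simp add: \<tau>_def k_def field_simps)
      finally show ?thesis .
    qed simp
    then show ?case by (simp add: L(1) span_eq_iff[THEN iffD2])
  qed
  have "\<exists>s. (s \<longlongrightarrow> 0) F \<and> (\<forall>\<^sub>F i in F. \<forall>v\<in>span (B \<union> L). \<bar>blinfun_apply (\<zeta> i) v\<bar> \<le> s i * norm v)"
    using B(1)
  proof (induction B rule: finite_induct)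
    case empty
    then show ?case using \<tau> onL by auto
  next
    case (insert b B)
    then obtain s where "(s \<longlongrightarrow> 0) F"
      "\<forall>\<^sub>F i in F. \<forall>v\<in>span (B \<union> L). \<bar>blinfun_apply (\<zeta> i) v\<bar> \<le> s i * norm v" by blast
    from vanishing_span_insert[OF lim this] show ?case unfolding Un_insert_left by blast
  qed
  then obtain s where s: "(s \<longlongrightarrow> 0) F"
    "\<forall>\<^sub>F i in F. \<forall>v\<in>span (B \<union> L). \<bar>blinfun_apply (\<zeta> i) v\<bar> \<le> s i * norm v" by blast
  have all: "v \<in> span (B \<union> L)" for v
  proof -
    have "v \<in> {x + y |x y. x \<in> closure L \<and> y \<in> span B}" using B(2) by simp
    then obtain x y where "v = x + y" "x \<in> L" "y \<in> span B" using L(2) by auto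
    then show ?thesis using span_mono[of B "B \<union> L"] by (auto intro!: span_add intro: span_base)
  qed
  have "\<forall>\<^sub>F i in F. norm (\<zeta> i) \<le> \<bar>s i\<bar>"
    using s(2)
  proof eventually_elim
    case (elim i)
    show ?case
    proof (rule norm_blinfun_bound)
      fix v
      show "norm (blinfun_apply (\<zeta> i) v) \<le> \<bar>s i\<bar> * norm v"
        using bspec[OF elim all[of v]] mult_right_mono[OF abs_ge_self[of "s i"] norm_ge_zero[of v]]
        by simp
    qed simp
  qed
  then have "\<forall>\<^sub>F i in F. norm (norm (\<zeta> i)) \<le> \<bar>s i\<bar>" by simp
  then show ?thesis using tendsto_rabs_zero[OF s(1)] by (rule Lim_null_comparison)
qed

section \<open>Hilbert spaces\<close>

lemma norm_inducing_innerD: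
  assumes ip: "norm_inducing_inner ip"
  shows ip_add_left: "ip (x + y) w = ip x w + ip y w"
    and ip_add_right: "ip w (x + y) = ip w x + ip w y"
    and ip_scale_left: "ip (c *\<^sub>R x) w = c * ip x w"
    and ip_scale_right: "ip w (c *\<^sub>R x) = c * ip w x"
    and ip_diff_left: "ip (x - y) w = ip x w - ip y w"
    and ip_diff_right: "ip w (x - y) = ip w x - ip w y"
    and ip_commute: "ip x y = ip y x"
    and ip_self: "ip x x = (norm x)\<^sup>2"
  using ip unfolding norm_inducing_inner_def
  by (auto simp: bilinear_ladd bilinear_radd bilinear_lmul bilinear_rmul bilinear_lsub bilinear_rsub)

text \<open>Polarization.\<close>
lemma norm_inducing_inner_unique:
  assumes "norm_inducing_inner ip" "norm_inducing_inner ip'"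
  shows "ip = ip'"
proof (intro ext)
  have pol: "4 * i x y = (norm (x + y))\<^sup>2 - (norm (x - y))\<^sup>2" if "norm_inducing_inner i" for i x y
    unfolding norm_inducing_innerD(8)[OF that, symmetric]
    using norm_inducing_innerD(7)[OF that, of x y]
    by (simp add: norm_inducing_innerD(1,2,5,6)[OF that])
  show "ip x y = ip' x y" for x y
    using pol[OF assms(1), of x y] pol[OF assms(2), of x y] by simp
qed

lemma parallelogram_norm:
  fixes ip :: "'x::banach \<Rightarrow> 'x \<Rightarrow> real" and x y :: 'x
  assumes ip: "norm_inducing_inner ip"
  shows "(norm (x + y))\<^sup>2 + (norm (x - y))\<^sup>2 = 2 * (norm x)\<^sup>2 + 2 * (norm y)\<^sup>2"
  unfolding ip_self[OF ip, symmetric]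
  by (simp add: norm_inducing_innerD(1,2,5,6)[OF ip])

text \<open>The parallelogram law bounds the distance of two points of \<open>C\<close> by the amounts by which they miss the
  minimal distance to \<open>x\<close> (the fact \<open>gap\<close>), because their midpoint lies in \<open>C\<close> too. So
  minimizing sequences are Cauchy, and minimizers are unique.\<close>
theorem ex1_nearest_point:
  fixes C :: "'x::banach set"
  assumes ip: "norm_inducing_inner (ip :: 'x \<Rightarrow> 'x \<Rightarrow> real)"
    and C: "closed C" "convex C" "C \<noteq> {}"
  shows "\<exists>!y. y \<in> C \<and> (\<forall>y'\<in>C. norm (x - y) \<le> norm (x - y'))"
proof -
  define d where "d = infdist x C"
  have d0: "0 \<le> d" by (simp add: d_def infdist_nonneg)
  have d_le: "d \<le> norm (x - q)" if "q \<in> C" for q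
    using infdist_le[OF that, of x] by (simp add: d_def dist_norm)
  have gap: "(norm (p - q))\<^sup>2 \<le> 2 * ((norm (x - p))\<^sup>2 - d\<^sup>2) + 2 * ((norm (x - q))\<^sup>2 - d\<^sup>2)"
    if p: "p \<in> C" and q: "q \<in> C" for p q
  proof -
    have "(1/2) *\<^sub>R p + (1/2) *\<^sub>R q \<in> C" by (rule convexD[OF C(2) p q]) auto
    from d_le[OF this] have "2 * d \<le> 2 * norm (x - ((1/2) *\<^sub>R p + (1/2) *\<^sub>R q))" by simp
    also have "\<dots> = norm (2 *\<^sub>R (x - ((1/2) *\<^sub>R p + (1/2) *\<^sub>R q)))" by simp
    also have "2 *\<^sub>R (x - ((1/2) *\<^sub>R p + (1/2) *\<^sub>R q)) = (x - p) + (x - q)"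
      by (simp add: algebra_simps scaleR_2)
    finally have "(2 * d)\<^sup>2 \<le> (norm ((x - p) + (x - q)))\<^sup>2" using d0 by (intro power_mono) auto
    moreover have "(norm ((x - p) - (x - q)))\<^sup>2 = (norm (p - q))\<^sup>2"
      by (simp add: norm_minus_commute)
    ultimately show ?thesis using parallelogram_norm[OF ip, of "x - p" "x - q"]
      by (simp add: power_mult_distrib)
  qed
  have "\<exists>q\<in>C. (norm (x - q))\<^sup>2 < d\<^sup>2 + 1 / Suc n" for n
  proof -
    have "d = sqrt (d\<^sup>2)" using d0 by simp
    also have "\<dots> < sqrt (d\<^sup>2 + 1 / Suc n)" by (intro real_sqrt_less_mono) simp
    finally have "(INF q\<in>C. dist x q) < sqrt (d\<^sup>2 + 1 / Suc n)"
      by (simp add: d_def infdist_notempty[OF C(3)])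
    then obtain q where q: "q \<in> C" "norm (x - q) < sqrt (d\<^sup>2 + 1 / Suc n)"
      using C(3) cInf_lessD[of "dist x ` C"] by (auto simp: dist_norm)
    then have "(norm (x - q))\<^sup>2 < (sqrt (d\<^sup>2 + 1 / Suc n))\<^sup>2" by (intro power_strict_mono) auto
    with q(1) show ?thesis by (auto intro!: bexI[of _ q])
  qed
  then obtain Y where Y: "\<And>n. Y n \<in> C" "\<And>n. (norm (x - Y n))\<^sup>2 < d\<^sup>2 + 1 / Suc n" by metis
  have "Cauchy Y"
  proof (rule metric_CauchyI)
    fix e :: real assume e: "0 < e"
    then have "0 < e\<^sup>2 / 4" by simp
    then obtain N where N: "1 / Suc N < e\<^sup>2 / 4" using nat_approx_posE by blast
    have "dist (Y m) (Y n) < e" if "N \<le> m" "N \<le> n" for m n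
    proof -
      have small: "(norm (x - Y k))\<^sup>2 - d\<^sup>2 < e\<^sup>2 / 4" if "N \<le> k" for k
      proof -
        have "1 / Suc k \<le> 1 / Suc N" using that by (intro frac_le) auto
        with Y(2)[of k] N show ?thesis by linarith
      qed
      have "(norm (Y m - Y n))\<^sup>2 < e\<^sup>2"
        using gap[OF Y(1) Y(1), of m n] add_strict_mono[OF small[OF that(1)] small[OF that(2)]]
        by simp
      then show ?thesis using e by (simp add: dist_norm power_less_imp_less_base)
    qed
    then show "\<exists>M. \<forall>m\<ge>M. \<forall>n\<ge>M. dist (Y m) (Y n) < e" by blast
  qed
  then obtain y where y: "Y \<longlonglongrightarrow> y" using Cauchy_convergent convergentD by blast
  have yC: "y \<in> C" using closed_sequentially[OF C(1) Y(1) y] .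
  have "(norm (x - y))\<^sup>2 \<le> d\<^sup>2"
  proof (rule LIMSEQ_le)
    show "(\<lambda>n. (norm (x - Y n))\<^sup>2) \<longlonglongrightarrow> (norm (x - y))\<^sup>2" by (intro tendsto_intros y)
    show "(\<lambda>n. d\<^sup>2 + 1 / Suc n) \<longlonglongrightarrow> d\<^sup>2"
      using tendsto_add[OF tendsto_const[of "d\<^sup>2"] LIMSEQ_inverse_real_of_nat]
      by (simp add: inverse_eq_divide)
    show "\<exists>N. \<forall>n\<ge>N. (norm (x - Y n))\<^sup>2 \<le> d\<^sup>2 + 1 / Suc n" using Y(2) less_imp_le by blast
  qed
  then have yd: "norm (x - y) \<le> d" using d0 by (rule power2_le_imp_le)
  show ?thesis
  proof (rule ex1I[of _ y])
    show "y \<in> C \<and> (\<forall>y'\<in>C. norm (x - y) \<le> norm (x - y'))" using yC yd d_le order_trans by blast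
    fix p assume p: "p \<in> C \<and> (\<forall>y'\<in>C. norm (x - p) \<le> norm (x - y'))"
    then have "norm (x - p) \<le> d" using yd yC order_trans by blast
    then have "(norm (x - p))\<^sup>2 \<le> d\<^sup>2" by (intro power_mono) auto
    from add_mono[OF this \<open>(norm (x - y))\<^sup>2 \<le> d\<^sup>2\<close>]
    have "2 * ((norm (x - p))\<^sup>2 - d\<^sup>2) + 2 * ((norm (x - y))\<^sup>2 - d\<^sup>2) \<le> 0" by simp
    with gap[of p y] p yC have "(norm (p - y))\<^sup>2 \<le> 0" by (meson order_trans)
    then show "p = y" by simp
  qed
qed

lemma metric_projection_nearest:
  fixes C :: "'x::banach set"
  assumes ip: "norm_inducing_inner (ip :: 'x \<Rightarrow> 'x \<Rightarrow> real)"
    and C: "closed C" "convex C" "C \<noteq> {}"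
  shows "metric_projection C x \<in> C"
    and "q \<in> C \<Longrightarrow> norm (x - metric_projection C x) \<le> norm (x - q)"
  using theI'[OF ex1_nearest_point[OF ip C, of x]] unfolding metric_projection_def by blast+

text \<open>The point of least norm on the hyperplane \<open>z = 1\<close> is orthogonal to the kernel of \<open>z\<close>.\<close>
lemma Riesz_representation:
  fixes z :: "'x::banach \<Rightarrow>\<^sub>L real"
  assumes ip: "norm_inducing_inner (ip :: 'x \<Rightarrow> 'x \<Rightarrow> real)"
  shows "\<exists>y. \<forall>x. blinfun_apply z x = ip y x"
proof (cases "z = 0")
  case True
  then show ?thesis using ip_scale_left[OF ip, of 0 0] by (intro exI[of _ 0]) simp
next
  case False
  then obtain x1 where x1: "blinfun_apply z x1 \<noteq> 0" by (metis blinfun_eqI zero_blinfun.rep_eq)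
  define C where "C = {x. blinfun_apply z x = 1}"
  have "closed C" unfolding C_def by (intro closed_Collect_eq continuous_intros)
  moreover have "convex C"
    unfolding C_def convex_def by (simp add: blinfun.add_right blinfun.scaleR_right)
  moreover have "(1 / blinfun_apply z x1) *\<^sub>R x1 \<in> C"
    using x1 by (simp add: C_def blinfun.scaleR_right)
  ultimately obtain y where y: "y \<in> C" "\<And>q. q \<in> C \<Longrightarrow> norm y \<le> norm q"
    using ex1_nearest_point[OF ip, of C 0] by (auto dest!: ex1_implies_ex)
  have orth: "ip y v = 0" if v: "blinfun_apply z v = 0" for v
  proof (rule ccontr)
    assume ne: "ip y v \<noteq> 0"
    have v0: "v \<noteq> 0"
    proof
      assume "v = 0"
      then show False using ne ip_scale_right[OF ip, of y 0 v] by simp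
    qed
    \<comment> \<open>The minimizer of the norm on the line \<open>y + t v\<close>.\<close>
    define t where "t = - ip y v / (norm v)\<^sup>2"
    have "y + t *\<^sub>R v \<in> C" using y(1) v by (simp add: C_def blinfun.add_right blinfun.scaleR_right)
    from power_mono[OF y(2)[OF this] norm_ge_zero, of 2]
    have "ip y y \<le> ip (y + t *\<^sub>R v) (y + t *\<^sub>R v)" by (simp add: ip_self[OF ip])
    also have "\<dots> = ip y y + 2 * t * ip y v + t\<^sup>2 * (norm v)\<^sup>2"
      by (simp add: norm_inducing_innerD(1-4)[OF ip] ip_commute[OF ip, of v y] ip_self[OF ip, of v]
          power2_eq_square algebra_simps)
    finally have "0 \<le> 2 * t * ip y v + t\<^sup>2 * (norm v)\<^sup>2" by simp
    also have "\<dots> = - ((ip y v)\<^sup>2 / (norm v)\<^sup>2)"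
      using v0 by (simp add: t_def power2_eq_square field_simps)
    finally have "(ip y v)\<^sup>2 / (norm v)\<^sup>2 \<le> 0" by simp
    moreover have "0 < (ip y v)\<^sup>2 / (norm v)\<^sup>2" using ne v0 by simp
    ultimately show False by simp
  qed
  have y0: "y \<noteq> 0" using y(1) by (auto simp: C_def)
  have "blinfun_apply z x = ip ((1 / (norm y)\<^sup>2) *\<^sub>R y) x" for x
  proof -
    have "ip y (x - blinfun_apply z x *\<^sub>R y) = 0"
      using y(1) by (intro orth) (simp add: C_def blinfun.diff_right blinfun.scaleR_right)
    then have "ip y x = blinfun_apply z x * (norm y)\<^sup>2"
      by (simp add: ip_diff_right[OF ip] ip_scale_right[OF ip] ip_self[OF ip])
    then show ?thesis using y0 by (simp add: ip_scale_left[OF ip])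
  qed
  then show ?thesis by blast
qed

lemma riesz_element_represents:
  fixes z :: "'x::banach \<Rightarrow>\<^sub>L real"
  assumes ip: "norm_inducing_inner (ip :: 'x \<Rightarrow> 'x \<Rightarrow> real)"
  shows "blinfun_apply z x = ip (riesz_element ip z) x"
proof -
  have "\<exists>!y. \<forall>x. blinfun_apply z x = ip y x"
  proof (rule ex_ex1I[OF Riesz_representation[OF ip]])
    fix y y' assume "\<forall>x. blinfun_apply z x = ip y x" "\<forall>x. blinfun_apply z x = ip y' x"
    then have "ip (y - y') (y - y') = 0" by (simp add: ip_diff_left[OF ip])
    then show "y = y'" by (simp add: ip_self[OF ip])
  qed
  from theI'[OF this] show ?thesis unfolding riesz_element_def by blast
qed

text \<open>The equality case of Cauchy--Schwarz: the functional \<open>(a, z)\<close> has norm at most one and attains at least the norm \<open>R\<close>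
  at \<open>(b, p)\<close>, so it is represented by \<open>(b, p) / R\<close>.\<close>
lemma norming_functional_Hilbert:
  fixes z :: "'x::banach \<Rightarrow>\<^sub>L real"
  assumes ip: "norm_inducing_inner (ip :: 'x \<Rightarrow> 'x \<Rightarrow> real)"
    and unit: "a\<^sup>2 + (norm z)\<^sup>2 \<le> 1"
    and R: "R\<^sup>2 = b\<^sup>2 + (norm p)\<^sup>2" "0 \<le> R" "R \<le> a * b + blinfun_apply z p"
  shows "ip p w = R * blinfun_apply z w"
proof -
  define y where "y = riesz_element ip z"
  have y: "blinfun_apply z x = ip y x" for x unfolding y_def by (rule riesz_element_represents[OF ip])
  have "(norm y)\<^sup>2 = blinfun_apply z y" by (simp add: y ip_self[OF ip])
  also have "\<dots> \<le> norm z * norm y" using norm_blinfun[of z y] by simp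
  finally have "norm y \<le> norm z" by (cases "y = 0") (simp_all add: power2_eq_square)
  then have "(norm y)\<^sup>2 \<le> (norm z)\<^sup>2" by (intro power_mono) auto
  with unit have "a\<^sup>2 + (norm y)\<^sup>2 \<le> 1" by linarith
  then have u: "R\<^sup>2 * (a\<^sup>2 + (norm y)\<^sup>2) \<le> R\<^sup>2 * 1" by (intro mult_left_mono) auto
  have v: "R * R \<le> R * (a * b + ip y p)" using R(2,3) by (intro mult_left_mono) (auto simp: y)
  have "(norm (R *\<^sub>R y - p))\<^sup>2 = R\<^sup>2 * (norm y)\<^sup>2 - 2 * R * ip y p + (norm p)\<^sup>2"
    unfolding ip_self[OF ip, symmetric] norm_inducing_innerD(3-6)[OF ip] ip_commute[OF ip, of p y]
    by (simp add: power2_eq_square algebra_simps)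
  moreover have "(R * a - b)\<^sup>2 = R\<^sup>2 * a\<^sup>2 - 2 * R * (a * b) + b\<^sup>2"
    by (simp add: power2_eq_square algebra_simps)
  ultimately have "(norm (R *\<^sub>R y - p))\<^sup>2 + (R * a - b)\<^sup>2
      = R\<^sup>2 * (a\<^sup>2 + (norm y)\<^sup>2) - 2 * (R * (a * b + ip y p)) + R\<^sup>2"
    using R(1) by (simp add: algebra_simps)
  also have "\<dots> \<le> 0" using u v by (simp add: power2_eq_square)
  finally have "R *\<^sub>R y = p" by (simp add: sum_power2_le_zero_iff)
  then show ?thesis using ip_scale_left[OF ip, of R y w] by (simp add: y)
qed

section \<open>Approximate multipliers\<close>

text \<open>With the distance from \<open>x\<close> to \<open>E\<close> for \<open>r\<close> this is sharp; with zero for \<open>r\<close> it bounds the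
  contribution of the first component alone.\<close>
lemma infdist_strip_ge:
  fixes E :: "'x::real_normed_vector set"
  assumes E: "E \<noteq> {}" and R: "\<And>e. e \<in> E \<Longrightarrow> r \<le> norm (x - e)" "0 \<le> r"
  shows "sqrt ((b - min b c)\<^sup>2 + r\<^sup>2) \<le> infdist (b, x) ({..c} \<times> E)"
proof -
  have ne: "{..c} \<times> E \<noteq> {}" using E by auto
  have "sqrt ((b - min b c)\<^sup>2 + r\<^sup>2) \<le> dist (b, x) q" if qQ: "q \<in> {..c} \<times> E" for q
  proof -
    obtain s e where q: "q = (s, e)" "s \<le> c" "e \<in> E" using qQ by auto
    have "\<bar>b - min b c\<bar> \<le> \<bar>b - s\<bar>" using q(2) by (auto simp: min_def)
    then have "(b - min b c)\<^sup>2 \<le> (b - s)\<^sup>2" unfolding abs_le_square_iff .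
    moreover have "r\<^sup>2 \<le> (norm (x - e))\<^sup>2" using R q(3) by (intro power_mono) auto
    ultimately show ?thesis by (simp add: q(1) dist_norm norm_Pair)
  qed
  then show ?thesis unfolding infdist_notempty[OF ne] using ne by (intro cINF_greatest)
qed

text \<open>The distance to \<open>{..c} \<times> E\<close> equals the Euclidean norm of \<open>(max (b - c) 0, dist(x, E))\<close>, and the
  conclusions are what the chain rule would give for its derivative \<open>(a, z)\<close>: \<open>a\<close> is a
  nonnegative multiple of \<open>max (b - c) 0\<close>, \<open>z\<close> is a multiple of an outer normal, which vanishes inside
  \<open>E\<close>, and in a Hilbert space \<open>z\<close> is a positive multiple of \<open>x\<close> minus its projection, up to
  the identification with the dual. They are derived from the subgradient inequality
  instead.\<close>
lemma subgradient_infdist_strip: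
  fixes E :: "'x::banach set"
  assumes E: "closed E" "E \<noteq> {}" and y: "(b, x) \<notin> {..c} \<times> E"
    and sg: "subgradient (\<lambda>y. infdist y ({..c} \<times> E)) (b, x) \<zeta>"
  defines "a \<equiv> blinfun_apply \<zeta> (1, 0)" and "z \<equiv> dual_snd \<zeta>"
  shows "a\<^sup>2 + (norm z)\<^sup>2 = 1" and "0 \<le> a"
    and "e \<in> E \<Longrightarrow> blinfun_apply z (e - x) \<le> 0"
    and "x \<in> E \<Longrightarrow> z = 0"
    and "\<lbrakk>norm_inducing_inner ip; convex E\<rbrakk> \<Longrightarrow>
      \<exists>R>0. \<forall>w. ip (x - metric_projection E x) w = R * blinfun_apply z w"
proof -
  define Q where "Q = {..c} \<times> E"
  define d where "d = infdist (b, x) Q"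
  have Q: "closed Q" "Q \<noteq> {}" using E by (auto simp: Q_def intro!: closed_Times)
  have d: "0 < d" using infdist_pos_not_in_closed[OF Q] y by (simp add: d_def Q_def)
  have app: "blinfun_apply \<zeta> (s, v) = s * a + blinfun_apply z v" for s v
    by (simp add: dual_prod_apply[of \<zeta> s v] a_def z_def)
  have gap: "d \<le> a * (b - s) + blinfun_apply z (x - e)" if "s \<le> c" "e \<in> E" for s e
    using subgradient_infdist_gap[OF sg, of "(s, e)"] that by (simp add: d_def Q_def app mult.commute)
  have "norm \<zeta> = 1" using subgradient_infdist_norm[OF sg[folded Q_def] Q] y by (simp add: Q_def)
  then show unit: "a\<^sup>2 + (norm z)\<^sup>2 = 1" using norm_dual_prod[of \<zeta>] by (simp add: a_def z_def)
  show "0 \<le> a"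
  proof (rule ccontr)
    assume "\<not> 0 \<le> a"
    then have a: "a < 0" by simp
    obtain e where e: "e \<in> E" using E by blast
    define B where "B = \<bar>a * (b - c) + blinfun_apply z (x - e)\<bar>"
    \<comment> \<open>For negative \<open>a\<close> the number \<open>s = c + B / a\<close> lies so far to the left that the gap inequality fails.\<close>
    have "d \<le> a * (b - (c + B / a)) + blinfun_apply z (x - e)"
      using a e by (intro gap) (auto simp: B_def divide_nonneg_neg divide_nonneg_nonpos)
    also have "a * (b - (c + B / a)) = a * (b - c) - B" using a by (simp add: algebra_simps)
    finally show False using d by (simp add: B_def)
  qed
  show "blinfun_apply z (e - x) \<le> 0" if e: "e \<in> E"
  proof -
    have "blinfun_apply z (e - x) = blinfun_apply \<zeta> (0, e - x)" by (simp add: app)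
    also have "\<dots> \<le> infdist ((b, x) + (0, e - x)) Q - d"
      using sg unfolding subgradient_def d_def Q_def by blast
    also have "(b, x) + (0, e - x) = (b, e)" by simp
    also have "infdist (b, e) Q \<le> d"
      unfolding d_def infdist_notempty[OF Q(2), of "(b, x)"] using Q(2)
    proof (rule cINF_greatest)
      fix q assume "q \<in> Q"
      then obtain s p where q: "q = (s, p)" "s \<le> c" by (auto simp: Q_def)
      have "infdist (b, e) Q \<le> dist (b, e) (s, e)" using q e by (intro infdist_le) (auto simp: Q_def)
      also have "\<dots> \<le> dist (b, x) q" using dist_fst_le[of "(b, x)" q] by (simp add: q dist_Pair_Pair)
      finally show "infdist (b, e) Q \<le> dist (b, x) q" .
    qed
    finally show ?thesis by simp
  qed
  show "z = 0" if x: "x \<in> E"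
  proof -
    have b: "c < b" using y x by auto
    have "sqrt ((b - min b c)\<^sup>2 + 0\<^sup>2) \<le> d"
      unfolding d_def Q_def by (rule infdist_strip_ge[OF E(2)]) auto
    then have "b - c \<le> d" using b by simp
    also have "d \<le> a * (b - c)" using gap[OF order_refl x] by simp
    finally have "1 * (b - c) \<le> a * (b - c)" by (simp only: mult_1)
    then have "1 \<le> a" by (rule mult_right_le_imp_le) (use b in simp)
    then have "1\<^sup>2 \<le> a\<^sup>2" by (intro power_mono) auto
    then have "(norm z)\<^sup>2 \<le> 0" using unit by (simp only: one_power2)
    then show ?thesis by simp
  qed
  show "\<exists>R>0. \<forall>w. ip (x - metric_projection E x) w = R * blinfun_apply z w"
    if ip: "norm_inducing_inner ip" and conv: "convex E"
  proof -
    define p where "p = metric_projection E x"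
    note p = metric_projection_nearest[OF ip E(1) conv E(2), where x = x, folded p_def]
    define R where "R = sqrt ((b - min b c)\<^sup>2 + (norm (x - p))\<^sup>2)"
    have Rd: "R \<le> d" unfolding R_def d_def Q_def by (intro infdist_strip_ge E p) auto
    have "d \<le> dist (b, x) (min b c, p)" unfolding d_def using p by (intro infdist_le) (auto simp: Q_def)
    also have "\<dots> = R" by (simp add: R_def dist_norm norm_Pair)
    finally have R0: "0 < R" using d by simp
    have "R \<le> a * (b - min b c) + blinfun_apply z (x - p)"
      using Rd gap[of "min b c" p] p by simp
    from norming_functional_Hilbert[OF ip _ _ _ this] unit R0
    show ?thesis unfolding p_def[symmetric] by (intro exI[of _ R]) (simp add: R_def)
  qed
qed

text \<open>The penalty function is the distance of \<open>(f0, f)\<close> to \<open>{..f0 u0 - \<epsilon>} \<times> E\<close>. By optimality of \<open>u0\<close>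
  it has no zeros on \<open>K\<close>, so the distance is differentiable at all values of \<open>(f0, f)\<close> on \<open>K\<close>. Its value
  at \<open>u0\<close> is at most \<open>\<epsilon>\<close>, and Ekeland's principle with slope \<open>sqrt \<epsilon>\<close> splits this evenly: the
  point it yields is within distance \<open>sqrt \<epsilon>\<close> of \<open>u0\<close>.\<close>
lemma approximate_multipliers:
  fixes K :: "'v::complete_space set" and E :: "'x::banach set"
    and f0 :: "'v \<Rightarrow> real" and f :: "'v \<Rightarrow> 'x"
  assumes K: "closed K" and sc: "strictly_convex_space TYPE('x \<Rightarrow>\<^sub>L real)"
    and E: "closed E" "convex E"
    and cont: "continuous_on UNIV f0" "continuous_on UNIV f"
    and u0: "u0 \<in> K" "f u0 \<in> E" and opt: "\<And>u. u \<in> K \<Longrightarrow> f u \<in> E \<Longrightarrow> f0 u0 \<le> f0 u"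
    and \<epsilon>: "0 < \<epsilon>"
  obtains u \<zeta> where "u \<in> K" "dist u u0 \<le> sqrt \<epsilon>"
    "norm \<zeta> = 1" "0 \<le> blinfun_apply \<zeta> (1, 0)"
    "\<And>\<xi>. \<xi> \<in> variation K (\<lambda>v. (f0 v, f v)) u \<Longrightarrow> - sqrt \<epsilon> \<le> blinfun_apply \<zeta> \<xi>"
    "\<And>e. e \<in> E \<Longrightarrow> blinfun_apply (dual_snd \<zeta>) (e - f u) \<le> 0"
    "f u \<in> E \<Longrightarrow> dual_snd \<zeta> = 0"
    "\<And>ip. norm_inducing_inner ip \<Longrightarrow>
      \<exists>R>0. \<forall>w. ip (f u - metric_projection E (f u)) w = R * blinfun_apply (dual_snd \<zeta>) w"
proof -
  define c where "c = f0 u0 - \<epsilon>"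
  define Q where "Q = {..c} \<times> E"
  define g where "g u = (f0 u, f u)" for u
  have Ene: "E \<noteq> {}" using u0 by auto
  have Q: "closed Q" "convex Q" "Q \<noteq> {}"
    using E Ene by (auto simp: Q_def intro!: closed_Times convex_Times)
  have sq: "0 < sqrt \<epsilon>" using \<epsilon> by simp
  have "continuous_on K (\<lambda>u. infdist (g u) Q)"
    unfolding g_def by (intro continuous_intros continuous_on_subset[OF cont(1)] continuous_on_subset[OF cont(2)]) auto
  then obtain u where u: "u \<in> K" "infdist (g u) Q + sqrt \<epsilon> * dist u u0 \<le> infdist (g u0) Q"
    "\<And>v. v \<in> K \<Longrightarrow> infdist (g u) Q - sqrt \<epsilon> * dist v u \<le> infdist (g v) Q"
    using Ekeland_variational_principle[of K "\<lambda>u. infdist (g u) Q", OF K _ infdist_nonneg u0(1) sq]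
    by blast
  have "infdist (g u0) Q \<le> dist (g u0) (c, f u0)" using u0 by (intro infdist_le) (simp add: Q_def)
  also have "\<dots> = \<epsilon>" using \<epsilon> by (simp add: g_def c_def dist_Pair_Pair dist_real_def)
  finally have "sqrt \<epsilon> * dist u u0 \<le> sqrt \<epsilon> * sqrt \<epsilon>"
    using u(2) infdist_nonneg[of "g u" Q] \<epsilon> by simp
  then have near: "dist u u0 \<le> sqrt \<epsilon>" using sq by (rule mult_left_le_imp_le)
  have out: "g u \<notin> Q" using opt[OF u(1)] \<epsilon> by (auto simp: Q_def g_def c_def)
  obtain \<zeta> where \<zeta>: "subgradient (\<lambda>x. infdist x Q) (g u) \<zeta>"
    "\<And>v. ((\<lambda>t. (infdist (g u + t *\<^sub>R v) Q - infdist (g u) Q) / t) \<longlongrightarrow> blinfun_apply \<zeta> v) (at_right 0)"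
    using infdist_Gateaux_differentiable[OF strictly_convex_dual_prod[OF sc] Q out] by blast
  note strip = subgradient_infdist_strip[OF E(1) Ene out[unfolded g_def Q_def] \<zeta>(1)[unfolded g_def Q_def]]
  show ?thesis
  proof (rule that[of u \<zeta>])
    show "norm \<zeta> = 1" by (rule subgradient_infdist_norm[OF \<zeta>(1) Q(1,3) out])
    fix \<xi> assume "\<xi> \<in> variation K (\<lambda>v. (f0 v, f v)) u"
    then have "\<xi> \<in> variation K g u" by (simp add: g_def[abs_def])
    from variation_derivative_ge[OF infdist_triangle_abs \<zeta>(2) this _ u(3)] \<epsilon>
    show "- sqrt \<epsilon> \<le> blinfun_apply \<zeta> \<xi>" by simp
  qed (use u(1) near strip E(2) in blast)+
qed

section \<open>The multiplier rule\<close>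

theorem theorem2p1:
  fixes K :: "'v::complete_space set"
    and E :: "'x::banach set"
    and f0 :: "'v \<Rightarrow> real"
    and f :: "'v \<Rightarrow> 'x"
    and u0 :: 'v
    and \<V> :: "'v \<Rightarrow> (real \<times> 'x) set"
    and \<l> :: "real \<Rightarrow> real"
  assumes "closed K"
    and "reflexive_space TYPE('x)"
    and "strictly_convex_space TYPE('x \<Rightarrow>\<^sub>L real)"
    and "E \<noteq> {}" and "closed E" and "convex E"
    and "continuous_on UNIV f0" and "continuous_on UNIV f"
    and "u0 \<in> K" and "f u0 \<in> E"
    and "\<forall>u\<in>K. f u \<in> E \<longrightarrow> f0 u0 \<le> f0 u"
    and "\<forall>u\<in>K. \<V> u \<subseteq> variation K (\<lambda>v. (f0 v, f v)) u"
    and "\<forall>s\<ge>0. \<l> s \<ge> 0" and "(\<l> \<longlongrightarrow> 0) (at_right 0)"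
    and H1: "approximable_at K \<V> \<l> u0"
    and H2: "\<exists>\<delta>>0. \<exists>C>0. \<forall>u\<in>K. dist u u0 \<le> \<delta> \<longrightarrow> (\<forall>\<xi>1 \<in> fst ` \<V> u. \<bar>\<xi>1\<bar> \<le> C)"
    and H3: "finite_codim {x - y | x y. x \<in> snd ` \<V> u0 \<and> y \<in> E}"
  shows "\<exists>(z0 :: real) (z :: 'x \<Rightarrow>\<^sub>L real).
    z0 \<ge> 0 \<and> (z0, z) \<noteq> (0, 0) \<and> z \<in> normal_cone E (f u0) \<and>
    (\<forall>(\<xi>1, \<xi>2) \<in> \<V> u0. z0 * \<xi>1 + blinfun_apply z \<xi>2 \<ge> 0) \<and>
    (z0 \<noteq> 0 \<longrightarrow> (\<forall>(\<xi>1, \<xi>2) \<in> \<V> u0. \<xi>1 + blinfun_apply (z /\<^sub>R z0) \<xi>2 \<ge> 0)) \<and>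
    (z \<noteq> 0 \<longrightarrow>
      (\<exists>u :: nat \<Rightarrow> 'v.
        (\<forall>k. u k \<in> K) \<and> u \<longlonglongrightarrow> u0 \<and>
        (\<forall>\<^sub>F k in sequentially. f (u k) \<notin> E) \<and>
        (\<lambda>k. infdist (f (u k)) E) \<longlonglongrightarrow> 0 \<and>
        (\<lambda>k. f0 (u k)) \<longlonglongrightarrow> f0 u0 \<and>
        (\<forall>ip. norm_inducing_inner ip \<longrightarrow>
          (\<lambda>k. metric_projection E (f (u k))) \<longlonglongrightarrow> f u0 \<and>
          (\<forall>k. ip (riesz_element ip z) (f (u k) - metric_projection E (f (u k))) > 0))))"
proof -
  note E = \<open>closed E\<close> \<open>convex E\<close> \<open>E \<noteq> {}\<close>
  have tend_f: "((\<lambda>i. f (v i)) \<longlongrightarrow> f u0) F" if "(v \<longlongrightarrow> u0) F" for v :: "'i \<Rightarrow> 'v" and F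
    using continuous_on_tendsto_compose[OF \<open>continuous_on UNIV f\<close> that] by simp
  \<comment> \<open>Approximate multipliers for all \<open>\<epsilon> > 0\<close> are chosen at once, as a family for which the approximation hypothesis can be stated.\<close>
  let ?M = "\<lambda>\<epsilon> u \<zeta>. u \<in> K \<and> dist u u0 \<le> sqrt \<epsilon> \<and> norm \<zeta> = 1 \<and> 0 \<le> blinfun_apply \<zeta> (1, 0) \<and>
    (\<forall>\<xi>\<in>\<V> u. - sqrt \<epsilon> \<le> blinfun_apply \<zeta> \<xi>) \<and>
    (\<forall>e\<in>E. blinfun_apply (dual_snd \<zeta>) (e - f u) \<le> 0) \<and> (f u \<in> E \<longrightarrow> dual_snd \<zeta> = 0) \<and>
    (\<forall>ip. norm_inducing_inner ip \<longrightarrow>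
      (\<exists>R>0. \<forall>w. ip (f u - metric_projection E (f u)) w = R * blinfun_apply (dual_snd \<zeta>) w))"
  have "\<exists>u \<zeta>. 0 < \<epsilon> \<longrightarrow> ?M \<epsilon> u \<zeta>" for \<epsilon>
  proof (cases "0 < \<epsilon>")
    case True
    show ?thesis
      by (rule approximate_multipliers[OF assms(1,3,5-10) _ True]) (use assms(11,12) in blast)+
  qed simp
  then obtain u \<zeta> where G: "\<And>\<epsilon>. 0 < \<epsilon> \<longrightarrow> ?M \<epsilon> (u \<epsilon>) (\<zeta> \<epsilon>)" by metis
  \<comment> \<open>Here \<open>a\<close> and \<open>z\<close> are the approximations of \<open>z0\<close> and \<open>z\<close>; their weak-star limits along \<open>F\<close> are \<open>a'\<close> and \<open>z'\<close>.\<close>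
  define a where "a \<epsilon> = blinfun_apply (\<zeta> \<epsilon>) (1, 0)" for \<epsilon>
  define z where "z \<epsilon> = dual_snd (\<zeta> \<epsilon>)" for \<epsilon>
  have uK: "u \<epsilon> \<in> K" and u_near: "dist (u \<epsilon>) u0 \<le> sqrt \<epsilon>" and a0: "0 \<le> a \<epsilon>"
    and \<zeta>1: "norm (\<zeta> \<epsilon>) = 1"
    and var: "\<And>\<xi>. \<xi> \<in> \<V> (u \<epsilon>) \<Longrightarrow> - sqrt \<epsilon> \<le> blinfun_apply (\<zeta> \<epsilon>) \<xi>"
    and cone: "\<And>e. e \<in> E \<Longrightarrow> blinfun_apply (z \<epsilon>) (e - f (u \<epsilon>)) \<le> 0"
    and outside: "f (u \<epsilon>) \<in> E \<Longrightarrow> z \<epsilon> = 0"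
    and hilb: "\<And>ip. norm_inducing_inner ip \<Longrightarrow>
      \<exists>R>0. \<forall>w. ip (f (u \<epsilon>) - metric_projection E (f (u \<epsilon>))) w = R * blinfun_apply (z \<epsilon>) w"
    if "0 < \<epsilon>" for \<epsilon>
    using G[of \<epsilon>] that by (auto simp: a_def z_def)
  have unit: "(a \<epsilon>)\<^sup>2 + (norm (z \<epsilon>))\<^sup>2 = 1" if "0 < \<epsilon>" for \<epsilon>
    using norm_dual_prod[of "\<zeta> \<epsilon>"] \<zeta>1[OF that] by (simp add: a_def z_def)
  have z1: "norm (z \<epsilon>) \<le> 1" if "0 < \<epsilon>" for \<epsilon>
  proof (rule power2_le_imp_le)
    have "(norm (z \<epsilon>))\<^sup>2 \<le> 1" using unit[OF that] zero_le_power2[of "a \<epsilon>"] by linarith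
    then show "(norm (z \<epsilon>))\<^sup>2 \<le> 1\<^sup>2" by simp
  qed simp
  have pos: "\<forall>\<^sub>F \<epsilon> in at_right (0::real). 0 < \<epsilon>" by (rule eventually_at_right_less)
  have "\<forall>\<^sub>F \<epsilon> in at_right 0. norm (\<zeta> \<epsilon>) \<le> 1" using pos by eventually_elim (simp add: \<zeta>1)
  from weak_star_cluster_point[OF _ this] obtain F \<eta> where F: "F \<le> at_right 0" "F \<noteq> bot"
    and weak: "\<And>x. ((\<lambda>\<epsilon>. blinfun_apply (\<zeta> \<epsilon>) x) \<longlongrightarrow> blinfun_apply \<eta> x) F" by auto
  define a' where "a' = blinfun_apply \<eta> (1, 0)"
  define z' where "z' = dual_snd \<eta>"
  have lim_a: "(a \<longlongrightarrow> a') F" using weak[of "(1, 0)"] by (simp add: a_def[abs_def] a'_def)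
  have lim_z: "((\<lambda>\<epsilon>. blinfun_apply (z \<epsilon>) x) \<longlongrightarrow> blinfun_apply z' x) F" for x
    using weak[of "(0, x)"] by (simp add: z_def z'_def dual_snd_apply)
  have posF: "\<forall>\<^sub>F \<epsilon> in F. 0 < \<epsilon>" by (rule filter_leD[OF F(1) pos])
  have sqrt0: "(sqrt \<longlongrightarrow> 0) (at_right 0)"
    using tendsto_real_sqrt[OF tendsto_ident_at[of 0 "{0<..}"]] by simp
  have sqrtF: "(sqrt \<longlongrightarrow> 0) F" by (rule tendsto_mono[OF F(1) sqrt0])
  have du: "((\<lambda>\<epsilon>. dist (u \<epsilon>) u0) \<longlongrightarrow> 0) (at_right 0)"
    by (rule tendsto_sandwich[OF _ _ tendsto_const sqrt0])
      (use pos u_near in \<open>auto elim: eventually_mono\<close>)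
  have u_lim: "(u \<longlongrightarrow> u0) F" using tendsto_mono[OF F(1) du] tendsto_dist_iff by blast
  have fu_lim: "((\<lambda>\<epsilon>. f (u \<epsilon>)) \<longlongrightarrow> f u0) F" by (rule tend_f[OF u_lim])
  have "(\<forall>\<epsilon>>0. u \<epsilon> \<in> K) \<and> ((\<lambda>\<epsilon>. dist u0 (u \<epsilon>)) \<longlongrightarrow> 0) (at_right 0)"
    using uK du by (simp add: dist_commute)
  with H1 have "\<exists>\<epsilon>0>0. \<forall>(\<xi>1, \<xi>2) \<in> \<V> u0. \<exists>\<eta>1 \<eta>2. (\<forall>\<epsilon>>0. (\<eta>1 \<epsilon>, \<eta>2 \<epsilon>) \<in> \<V> (u \<epsilon>)) \<and>
        (\<eta>1 \<longlongrightarrow> \<xi>1) (at_right 0) \<and>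
        (\<forall>\<epsilon>. 0 < \<epsilon> \<and> \<epsilon> < \<epsilon>0 \<longrightarrow> norm (\<xi>2 - \<eta>2 \<epsilon>) \<le> \<l> (dist u0 (u \<epsilon>)))"
    unfolding approximable_at_def by (elim allE[of _ u]) (drule (1) mp)
  then obtain \<epsilon>0 where \<epsilon>0: "0 < \<epsilon>0"
    and app: "\<And>\<xi>1 \<xi>2. (\<xi>1, \<xi>2) \<in> \<V> u0 \<Longrightarrow> \<exists>\<eta>1 \<eta>2. (\<forall>\<epsilon>>0. (\<eta>1 \<epsilon>, \<eta>2 \<epsilon>) \<in> \<V> (u \<epsilon>)) \<and>
        (\<eta>1 \<longlongrightarrow> \<xi>1) (at_right 0) \<and>
        (\<forall>\<epsilon>. 0 < \<epsilon> \<and> \<epsilon> < \<epsilon>0 \<longrightarrow> norm (\<xi>2 - \<eta>2 \<epsilon>) \<le> \<l> (dist u0 (u \<epsilon>)))"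
  proof (elim exE conjE)
    fix \<epsilon>0 assume a: "0 < \<epsilon>0" and b: "\<forall>(\<xi>1, \<xi>2) \<in> \<V> u0. \<exists>\<eta>1 \<eta>2. (\<forall>\<epsilon>>0. (\<eta>1 \<epsilon>, \<eta>2 \<epsilon>) \<in> \<V> (u \<epsilon>)) \<and>
        (\<eta>1 \<longlongrightarrow> \<xi>1) (at_right 0) \<and>
        (\<forall>\<epsilon>. 0 < \<epsilon> \<and> \<epsilon> < \<epsilon>0 \<longrightarrow> norm (\<xi>2 - \<eta>2 \<epsilon>) \<le> \<l> (dist u0 (u \<epsilon>)))"
    show thesis by (rule that[OF a]) (drule bspec[OF b], simp only: prod.case)
  qed
  \<comment> \<open>The value \<open>\<l> 0\<close> may be positive, so the given approximants are of no use where \<open>u \<epsilon> = u0\<close>. There the point \<open>(\<xi>1, \<xi>2)\<close> approximates itself, with error zero.\<close>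
  define \<rho> where "\<rho> \<epsilon> = (if u \<epsilon> = u0 then 0 else \<l> (dist u0 (u \<epsilon>)))" for \<epsilon>
  have \<rho>_lim: "(\<rho> \<longlongrightarrow> 0) F"
  proof (rule tendstoI)
    fix e :: real assume "0 < e"
    with \<open>(\<l> \<longlongrightarrow> 0) (at_right 0)\<close> have "\<forall>\<^sub>F s in at_right 0. dist (\<l> s) 0 < e" by (rule tendstoD)
    then obtain b where b: "0 < b" "\<And>s. 0 < s \<Longrightarrow> s < b \<Longrightarrow> dist (\<l> s) 0 < e"
      unfolding eventually_at_right_field by blast
    have "\<forall>\<^sub>F \<epsilon> in F. dist (u \<epsilon>) u0 < b" using tendstoD[OF u_lim b(1)] .
    then show "\<forall>\<^sub>F \<epsilon> in F. dist (\<rho> \<epsilon>) 0 < e"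
      by eventually_elim (use b \<open>0 < e\<close> in \<open>auto simp: \<rho>_def dist_commute\<close>)
  qed
  have app': "\<exists>\<eta>1 \<eta>2. (\<forall>\<epsilon>>0. (\<eta>1 \<epsilon>, \<eta>2 \<epsilon>) \<in> \<V> (u \<epsilon>)) \<and> (\<eta>1 \<longlongrightarrow> \<xi>1) F \<and>
        (\<forall>\<epsilon>. 0 < \<epsilon> \<and> \<epsilon> < \<epsilon>0 \<longrightarrow> norm (\<xi>2 - \<eta>2 \<epsilon>) \<le> \<rho> \<epsilon>)" if \<xi>: "(\<xi>1, \<xi>2) \<in> \<V> u0" for \<xi>1 \<xi>2
  proof -
    obtain \<eta>1 \<eta>2 where \<eta>: "\<And>\<epsilon>. 0 < \<epsilon> \<Longrightarrow> (\<eta>1 \<epsilon>, \<eta>2 \<epsilon>) \<in> \<V> (u \<epsilon>)" "(\<eta>1 \<longlongrightarrow> \<xi>1) (at_right 0)"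
      "\<And>\<epsilon>. 0 < \<epsilon> \<Longrightarrow> \<epsilon> < \<epsilon>0 \<Longrightarrow> norm (\<xi>2 - \<eta>2 \<epsilon>) \<le> \<l> (dist u0 (u \<epsilon>))"
      using app[OF \<xi>] by blast
    have "((\<lambda>\<epsilon>. if u \<epsilon> = u0 then \<xi>1 else \<eta>1 \<epsilon>) \<longlongrightarrow> \<xi>1) F"
    proof (rule tendstoI)
      fix e :: real assume e: "0 < e"
      have "\<forall>\<^sub>F \<epsilon> in F. dist (\<eta>1 \<epsilon>) \<xi>1 < e"
        by (rule tendstoD[OF tendsto_mono[OF F(1) \<eta>(2)] e])
      then show "\<forall>\<^sub>F \<epsilon> in F. dist (if u \<epsilon> = u0 then \<xi>1 else \<eta>1 \<epsilon>) \<xi>1 < e"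
        by eventually_elim (use e in simp)
    qed
    then show ?thesis
      using \<xi> \<eta>(1,3)
      by (intro exI[of _ "\<lambda>\<epsilon>. if u \<epsilon> = u0 then \<xi>1 else \<eta>1 \<epsilon>"] exI[of _ "\<lambda>\<epsilon>. if u \<epsilon> = u0 then \<xi>2 else \<eta>2 \<epsilon>"])
        (auto simp: \<rho>_def)
  qed
  have small: "\<forall>\<^sub>F \<epsilon> in F. 0 < \<epsilon> \<and> \<epsilon> < \<epsilon>0"
    by (rule filter_leD[OF F(1)]) (use \<epsilon>0 in \<open>auto simp: eventually_at_right_field\<close>)
  have split: "blinfun_apply (\<zeta> \<epsilon>) (s, x) = s * a \<epsilon> + blinfun_apply (z \<epsilon>) x" for \<epsilon> s x
    by (simp add: dual_prod_apply[of "\<zeta> \<epsilon>" s x] a_def z_def)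
  \<comment> \<open>Replacing \<open>\<eta>2\<close> by \<open>\<xi>2\<close> costs at most \<open>\<rho> \<epsilon>\<close>, as \<open>z \<epsilon>\<close> has norm at most one.\<close>
  have perturb: "- sqrt \<epsilon> - \<rho> \<epsilon> \<le> \<eta>1 * a \<epsilon> + blinfun_apply (z \<epsilon>) \<xi>2"
    if "0 < \<epsilon>" "(\<eta>1, \<eta>2) \<in> \<V> (u \<epsilon>)" "norm (\<xi>2 - \<eta>2) \<le> \<rho> \<epsilon>" for \<epsilon> \<eta>1 \<eta>2 \<xi>2
  proof -
    have "\<bar>blinfun_apply (z \<epsilon>) (\<xi>2 - \<eta>2)\<bar> \<le> norm (z \<epsilon>) * norm (\<xi>2 - \<eta>2)"
      using norm_blinfun[of "z \<epsilon>" "\<xi>2 - \<eta>2"] by simp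
    also have "\<dots> \<le> 1 * \<rho> \<epsilon>" using z1[OF that(1)] that(3) by (intro mult_mono) auto
    finally show ?thesis using var[OF that(1,2)] by (simp add: split blinfun.diff_right)
  qed
  have mult: "0 \<le> a' * \<xi>1 + blinfun_apply z' \<xi>2" if \<xi>: "(\<xi>1, \<xi>2) \<in> \<V> u0" for \<xi>1 \<xi>2
  proof -
    obtain \<eta>1 \<eta>2 where \<eta>: "\<And>\<epsilon>. 0 < \<epsilon> \<Longrightarrow> (\<eta>1 \<epsilon>, \<eta>2 \<epsilon>) \<in> \<V> (u \<epsilon>)" "(\<eta>1 \<longlongrightarrow> \<xi>1) F"
      "\<And>\<epsilon>. 0 < \<epsilon> \<Longrightarrow> \<epsilon> < \<epsilon>0 \<Longrightarrow> norm (\<xi>2 - \<eta>2 \<epsilon>) \<le> \<rho> \<epsilon>"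
      using app'[OF \<xi>] by blast
    have "- 0 - 0 \<le> \<xi>1 * a' + blinfun_apply z' \<xi>2"
    proof (rule tendsto_le[OF F(2)])
      show "((\<lambda>\<epsilon>. \<eta>1 \<epsilon> * a \<epsilon> + blinfun_apply (z \<epsilon>) \<xi>2) \<longlongrightarrow> \<xi>1 * a' + blinfun_apply z' \<xi>2) F"
        by (intro tendsto_add tendsto_mult \<eta>(2) lim_a lim_z)
      show "((\<lambda>\<epsilon>. - sqrt \<epsilon> - \<rho> \<epsilon>) \<longlongrightarrow> - 0 - 0) F"
        by (intro tendsto_diff tendsto_minus sqrtF \<rho>_lim)
      show "\<forall>\<^sub>F \<epsilon> in F. - sqrt \<epsilon> - \<rho> \<epsilon> \<le> \<eta>1 \<epsilon> * a \<epsilon> + blinfun_apply (z \<epsilon>) \<xi>2"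
        using small by eventually_elim (use perturb \<eta> in blast)
    qed
    then show ?thesis by (simp add: mult.commute)
  qed
  have a'0: "0 \<le> a'"
    by (rule tendsto_lowerbound[OF lim_a _ F(2)]) (use posF a0 in \<open>auto elim: eventually_mono\<close>)
  have zfu: "((\<lambda>\<epsilon>. blinfun_apply (z \<epsilon>) (f (u \<epsilon>) - f u0)) \<longlongrightarrow> 0) F"
  proof (rule Lim_null_comparison)
    show "((\<lambda>\<epsilon>. norm (f (u \<epsilon>) - f u0)) \<longlongrightarrow> 0) F"
      using fu_lim by (simp add: tendsto_norm_zero_iff LIM_zero_iff)
    show "\<forall>\<^sub>F \<epsilon> in F. norm (blinfun_apply (z \<epsilon>) (f (u \<epsilon>) - f u0)) \<le> norm (f (u \<epsilon>) - f u0)"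
      using posF
    proof eventually_elim
      case (elim \<epsilon>)
      show ?case
        using norm_blinfun[of "z \<epsilon>" "f (u \<epsilon>) - f u0"]
          mult_right_mono[OF z1[OF elim] norm_ge_zero[of "f (u \<epsilon>) - f u0"]] by simp
    qed
  qed
  have normal: "z' \<in> normal_cone E (f u0)"
    unfolding normal_cone_def
  proof (intro CollectI ballI)
    fix e assume e: "e \<in> E"
    show "blinfun_apply z' (e - f u0) \<le> 0"
    proof (rule tendsto_le[OF F(2) zfu lim_z])
      show "\<forall>\<^sub>F \<epsilon> in F. blinfun_apply (z \<epsilon>) (e - f u0) \<le> blinfun_apply (z \<epsilon>) (f (u \<epsilon>) - f u0)"
        using posF by eventually_elim (use cone[OF _ e] in \<open>simp add: blinfun.diff_right\<close>)
    qed
  qed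
  have nonzero: "(a', z') \<noteq> (0, 0)"
  proof
    assume "(a', z') = (0, 0)"
    then have a'z: "a' = 0" and z'z: "z' = 0" by auto
    obtain \<delta> C where \<delta>: "0 < \<delta>" and C: "\<And>u \<xi>1 \<xi>2. u \<in> K \<Longrightarrow> dist u u0 \<le> \<delta> \<Longrightarrow> (\<xi>1, \<xi>2) \<in> \<V> u \<Longrightarrow> \<bar>\<xi>1\<bar> \<le> C"
      using H2 by force
    \<comment> \<open>The lower bound for \<open>z \<epsilon>\<close> on the set of \<open>\<xi>2 - e\<close>. It is uniform because \<open>\<xi>1\<close> enters only through the local bound \<open>C\<close> and is multiplied by \<open>a \<epsilon>\<close>, which would tend to zero.\<close>
    define \<sigma> where "\<sigma> \<epsilon> = sqrt \<epsilon> + \<rho> \<epsilon> + C * a \<epsilon> + blinfun_apply (z \<epsilon>) (f (u \<epsilon>) - f u0) + blinfun_apply (z \<epsilon>) (f u0)" for \<epsilon>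
    have "((\<lambda>\<epsilon>. sqrt \<epsilon> + \<rho> \<epsilon> + C * a \<epsilon> + blinfun_apply (z \<epsilon>) (f (u \<epsilon>) - f u0) + blinfun_apply (z \<epsilon>) (f u0))
        \<longlongrightarrow> 0 + 0 + C * a' + 0 + blinfun_apply z' (f u0)) F"
      by (intro tendsto_add sqrtF \<rho>_lim tendsto_mult_left lim_a zfu lim_z)
    then have \<sigma>: "(\<sigma> \<longlongrightarrow> 0) F" by (simp add: \<sigma>_def[abs_def] a'z z'z)
    have "\<forall>\<^sub>F \<epsilon> in F. dist (u \<epsilon>) u0 < \<delta>" using tendstoD[OF u_lim \<delta>] .
    with small have low: "\<forall>\<^sub>F \<epsilon> in F. \<forall>x\<in>{x - y | x y. x \<in> snd ` \<V> u0 \<and> y \<in> E}. - \<sigma> \<epsilon> \<le> blinfun_apply (z \<epsilon>) x"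
    proof eventually_elim
      case (elim \<epsilon>)
      then have \<epsilon>: "0 < \<epsilon>" "\<epsilon> < \<epsilon>0" by auto
      show ?case
      proof
        fix x assume "x \<in> {x - y | x y. x \<in> snd ` \<V> u0 \<and> y \<in> E}"
        then obtain \<xi>1 \<xi>2 e where x: "x = \<xi>2 - e" "(\<xi>1, \<xi>2) \<in> \<V> u0" "e \<in> E" by auto
        obtain \<eta>1 \<eta>2 where \<eta>: "(\<eta>1, \<eta>2) \<in> \<V> (u \<epsilon>)" "norm (\<xi>2 - \<eta>2) \<le> \<rho> \<epsilon>"
          using app'[OF x(2)] \<epsilon> by blast
        have "\<bar>\<eta>1\<bar> \<le> C" using C[OF uK[OF \<epsilon>(1)] _ \<eta>(1)] elim by simp
        then have "\<eta>1 * a \<epsilon> \<le> C * a \<epsilon>" using a0[OF \<epsilon>(1)] by (intro mult_right_mono) auto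
        then show "- \<sigma> \<epsilon> \<le> blinfun_apply (z \<epsilon>) x"
          using perturb[OF \<epsilon>(1) \<eta>] cone[OF \<epsilon>(1) x(3)]
          by (simp add: \<sigma>_def x(1) blinfun.diff_right)
      qed
    qed
    \<comment> \<open>So the unit functionals \<open>(a \<epsilon>, z \<epsilon>)\<close> would tend to zero in norm.\<close>
    have "((\<lambda>\<epsilon>. norm (z \<epsilon>)) \<longlongrightarrow> 0) F"
      using lim_z by (intro finite_codim_imp_norm_tendsto_0[OF H3 _ \<sigma> low]) (simp add: z'z)
    then have "((\<lambda>\<epsilon>. (a \<epsilon>)\<^sup>2 + (norm (z \<epsilon>))\<^sup>2) \<longlongrightarrow> 0\<^sup>2 + 0\<^sup>2) F"
      using lim_a a'z by (intro tendsto_add tendsto_power) auto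
    moreover have "\<forall>\<^sub>F \<epsilon> in F. (a \<epsilon>)\<^sup>2 + (norm (z \<epsilon>))\<^sup>2 = 1"
      using posF by eventually_elim (rule unit)
    ultimately have "((\<lambda>\<epsilon>. 1::real) \<longlongrightarrow> 0\<^sup>2 + 0\<^sup>2) F" by (rule Lim_transform_eventually)
    from tendsto_unique[OF F(2) tendsto_const this] show False by simp
  qed
  have seq: "\<exists>v :: nat \<Rightarrow> 'v.
        (\<forall>k. v k \<in> K) \<and> v \<longlonglongrightarrow> u0 \<and>
        (\<forall>\<^sub>F k in sequentially. f (v k) \<notin> E) \<and>
        (\<lambda>k. infdist (f (v k)) E) \<longlonglongrightarrow> 0 \<and>
        (\<lambda>k. f0 (v k)) \<longlonglongrightarrow> f0 u0 \<and>
        (\<forall>ip. norm_inducing_inner ip \<longrightarrow>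
          (\<lambda>k. metric_projection E (f (v k))) \<longlonglongrightarrow> f u0 \<and>
          (\<forall>k. ip (riesz_element ip z') (f (v k) - metric_projection E (f (v k))) > 0))" if z'0: "z' \<noteq> 0"
  proof -
    \<comment> \<open>Only one inner product can induce the norm, so a single vector \<open>w\<close> is the Riesz representative for all of them. The sequence is then chosen so that \<open>z \<epsilon>\<close> is positive at \<open>w\<close>.\<close>
    obtain w where w: "0 < blinfun_apply z' w"
      and w_riesz: "\<And>ip. norm_inducing_inner ip \<Longrightarrow> w = riesz_element ip z'"
    proof (cases "\<exists>ip :: 'x \<Rightarrow> 'x \<Rightarrow> real. norm_inducing_inner ip")
      case True
      then obtain ip :: "'x \<Rightarrow> 'x \<Rightarrow> real" where ip: "norm_inducing_inner ip" by blast
      note rep = riesz_element_represents[OF ip, of z']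
      have "riesz_element ip z' \<noteq> 0"
      proof
        assume "riesz_element ip z' = 0"
        then have "blinfun_apply z' x = 0" for x using rep[of x] ip_scale_left[OF ip, of 0 0 x] by simp
        with z'0 show False by (metis blinfun_eqI zero_blinfun.rep_eq)
      qed
      then have "0 < blinfun_apply z' (riesz_element ip z')" by (simp add: rep ip_self[OF ip])
      then show ?thesis using norm_inducing_inner_unique[OF _ ip] by (intro that) auto
    next
      case False
      obtain x where "blinfun_apply z' x \<noteq> 0" using z'0 by (metis blinfun_eqI zero_blinfun.rep_eq)
      then have "0 < blinfun_apply z' x \<or> 0 < blinfun_apply z' (- x)" by (auto simp: blinfun.minus_right)
      then show ?thesis using False that by blast
    qed
    have "\<exists>\<epsilon>. 0 < \<epsilon> \<and> \<epsilon> < 1 / real (Suc k) \<and> 0 < blinfun_apply (z \<epsilon>) w" for k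
    proof -
      have "\<forall>\<^sub>F \<epsilon> in at_right 0. \<epsilon> < 1 / real (Suc k)"
        unfolding eventually_at_right_field by (intro exI[of _ "1 / real (Suc k)"]) simp
      then have "\<forall>\<^sub>F \<epsilon> in F. \<epsilon> < 1 / real (Suc k)" by (rule filter_leD[OF F(1)])
      with posF order_tendstoD(1)[OF lim_z w]
      have "\<forall>\<^sub>F \<epsilon> in F. 0 < \<epsilon> \<and> \<epsilon> < 1 / real (Suc k) \<and> 0 < blinfun_apply (z \<epsilon>) w"
        by eventually_elim simp
      then show ?thesis using F(2) by (rule eventually_happens'[rotated])
    qed
    then obtain t where t: "\<And>k. 0 < t k" "\<And>k. t k < 1 / real (Suc k)"
      "\<And>k. 0 < blinfun_apply (z (t k)) w" by metis
    define v where "v k = u (t k)" for k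
    have "(\<lambda>k. dist (v k) u0) \<longlonglongrightarrow> 0"
    proof (rule Lim_null_comparison)
      show "(\<lambda>k. sqrt (1 / real (Suc k))) \<longlonglongrightarrow> 0"
        using tendsto_real_sqrt[OF LIMSEQ_inverse_real_of_nat] by (simp add: inverse_eq_divide)
      show "\<forall>\<^sub>F k in sequentially. norm (dist (v k) u0) \<le> sqrt (1 / real (Suc k))"
      proof (rule always_eventually, rule allI)
        fix k
        have "dist (v k) u0 \<le> sqrt (t k)" unfolding v_def by (rule u_near[OF t(1)])
        also have "\<dots> \<le> sqrt (1 / real (Suc k))"
          using t(2)[of k] by (intro real_sqrt_le_mono less_imp_le)
        finally show "norm (dist (v k) u0) \<le> sqrt (1 / real (Suc k))" by simp
      qed
    qed
    then have v_lim: "v \<longlonglongrightarrow> u0" by (simp add: tendsto_dist_iff[symmetric])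
    have fv: "(\<lambda>k. f (v k)) \<longlonglongrightarrow> f u0" by (rule tend_f[OF v_lim])
    have out: "f (v k) \<notin> E" for k using outside[OF t(1), of k] t(3)[of k] by (auto simp: v_def)
    have "(\<lambda>k. infdist (f (v k)) E) \<longlonglongrightarrow> infdist (f u0) E" by (rule tendsto_infdist[OF fv])
    then have dist0: "(\<lambda>k. infdist (f (v k)) E) \<longlonglongrightarrow> 0" using \<open>f u0 \<in> E\<close> by simp
    have f0v: "(\<lambda>k. f0 (v k)) \<longlonglongrightarrow> f0 u0"
      using continuous_on_tendsto_compose[OF \<open>continuous_on UNIV f0\<close> v_lim] by simp
    have proj: "(\<lambda>k. metric_projection E (f (v k))) \<longlonglongrightarrow> f u0"
      if ip: "norm_inducing_inner (ip :: 'x \<Rightarrow> 'x \<Rightarrow> real)" for ip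
    proof -
      have "(\<lambda>k. f (v k) - metric_projection E (f (v k))) \<longlonglongrightarrow> 0"
      proof (rule Lim_null_comparison)
        show "(\<lambda>k. norm (f (v k) - f u0)) \<longlonglongrightarrow> 0"
          using fv by (simp add: tendsto_norm_zero_iff LIM_zero_iff)
        show "\<forall>\<^sub>F k in sequentially. norm (f (v k) - metric_projection E (f (v k))) \<le> norm (f (v k) - f u0)"
          using metric_projection_nearest(2)[OF ip E \<open>f u0 \<in> E\<close>] by simp
      qed
      from tendsto_diff[OF fv this] show ?thesis by simp
    qed
    have sign: "0 < ip (riesz_element ip z') (f (v k) - metric_projection E (f (v k)))"
      if ip: "norm_inducing_inner (ip :: 'x \<Rightarrow> 'x \<Rightarrow> real)" for ip k
    proof -
      obtain R where R: "0 < R"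
        "\<And>w. ip (f (v k) - metric_projection E (f (v k))) w = R * blinfun_apply (z (t k)) w"
        using hilb[OF t(1) ip, of k] unfolding v_def by blast
      show ?thesis
        unfolding ip_commute[OF ip, of "riesz_element ip z'"] R(2)
        using R(1) t(3)[of k] w_riesz[OF ip] by simp
    qed
    show ?thesis
      using uK[OF t(1)] v_lim out dist0 f0v proj sign
      by (intro exI[of _ v]) (auto simp: v_def)
  qed
  have norm1: "\<xi>1 + blinfun_apply (z' /\<^sub>R a') \<xi>2 \<ge> 0" if "a' \<noteq> 0" "(\<xi>1, \<xi>2) \<in> \<V> u0" for \<xi>1 \<xi>2
  proof -
    have "0 \<le> (a' * \<xi>1 + blinfun_apply z' \<xi>2) / a'"
      using mult[OF that(2)] a'0 by simp
    also have "\<dots> = \<xi>1 + blinfun_apply (z' /\<^sub>R a') \<xi>2"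
      using that(1) by (simp add: blinfun.scaleR_left field_simps)
    finally show ?thesis .
  qed
  show ?thesis
    using a'0 nonzero normal mult norm1 seq
    by (intro exI[of _ a'] exI[of _ z']) blast
qed

end
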